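(* Let $k\ge 2$. For any $w\in F_k$ the set $Aut(F_k)w$ is exponentially negligible in $F_k$ and the set $C\cap Aut(F_k)w$ is exponentially negligible in $C$. Moreover, $$H(Aut(F_k)w)\le H(F_k-SM')<2k-1.$$
   Context: $F_k=F(a_1,\dots,a_k)$ is the free group of rank $k\ge2$ and $\Sigma=\{a_1,\dots,a_k\}^{\pm1}$. Elements of $F_k$ are identified with freely reduced words over $\Sigma$, and $|w|$ is word length. A word is cyclically reduced if all its cyclic permutations are reduced; $C$ is the set of all cyclically reduced words. Every reduced word $w$ is uniquely a concatenation $w=vuv^{-1}$ with $u$ cyclically reduced; $u$ is the cyclically reduced form of $w$ and $\|w\|:=|u|$. A Whitehead automorphism of the second kind is an automorphism $\tau$ of $F_k$ for which there is $a\in\Sigma$ such that $\tau(x)\in\{x,xa,a^{-1}x,a^{-1}xa\}$ for all $x\in\Sigma$. A cyclically reduced $w\in F_k$ is strictly minimal if $\|\tau(w)\|>|w|$ for every non-inner Whitehead automorphism $\tau$ of the second kind. $SM$ is the set of strictly minimal elements, and $SM'$ is the set of all $w\in F_k$ whose cyclically reduced form belongs to $SM$. For a set $S$ of words over $\Sigma$, $\rho(n,S)$ is the number of $w\in S$ with $|w|\le n$. A real sequence $x_n\to x$ converges exponentially fast if there are $0<\sigma<1$, $K>0$ with $|x-x_n|\le K\sigma^n$ for all $n\ge1$. $B\subseteq S$ is exponentially generic in $S$ if $\rho(n,B)/\rho(n,S)\to1$ exponentially fast, and exponentially negligible in $S$ if $S-B$ is exponentially generic in $S$. For $S\subseteq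 F_k$, the exponential growth rate (growth entropy) of $S$ is $H(S):=\limsup_{n\to\infty}\sqrt[n]{\rho(n,S)}$. *)

theory Defs
  imports "HOL-Algebra.Bij" "HOL-Library.Extended_Real"
begin

section \<open>The free group of rank k as a group of freely reduced words\<close>

text \<open>The letter \<open>(i, True)\<close> stands for the generator \<open>a_(i+1)\<close>, and \<open>(i, False)\<close> for its
  inverse.\<close>

type_synonym letter = "nat \<times> bool"

definition letters :: "nat \<Rightarrow> letter set" where
  "letters k = {..<k} \<times> UNIV"

definition linv :: "letter \<Rightarrow> letter" where
  "linv x = (fst x, \<not> snd x)"

definition winv :: "letter list \<Rightarrow> letter list" where
  "winv w = rev (map linv w)"

definition reduced :: "letter list \<Rightarrow> bool" where
  "reduced w \<longleftrightarrow> successively (\<lambda>x y. y \<noteq> linv x) w"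

text \<open>\<open>push x w\<close> is the reduced form of \<open>x # w\<close> if \<open>w\<close> is reduced.\<close>

fun push :: "letter \<Rightarrow> letter list \<Rightarrow> letter list" where
  "push x [] = [x]"
| "push x (y # ys) = (if y = linv x then ys else x # y # ys)"

definition reduce :: "letter list \<Rightarrow> letter list" where
  "reduce w = foldr push w []"

definition free_group :: "nat \<Rightarrow> letter list monoid" where
  "free_group k = \<lparr>carrier = {w. set w \<subseteq> letters k \<and> reduced w},
                   monoid.mult = (\<lambda>u v. reduce (u @ v)),
                   one = []\<rparr>"

lemma linv_linv [simp]: "linv (linv x) = x"
  by (simp add: linv_def)

lemma linv_neq [simp]: "linv x \<noteq> x" "x \<noteq> linv x"
  by (simp_all add: linv_def prod_eq_iff)

lemma linv_eq_iff [simp]: "linv x = linv y \<longleftrightarrow> x = y"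
  by (metis linv_linv)

lemma linv_letters [simp]: "linv x \<in> letters k \<longleftrightarrow> x \<in> letters k"
  by (auto simp: linv_def letters_def mem_Times_iff)

lemma reduced_Nil [simp]: "reduced []"
  by (simp add: reduced_def)

lemma reduced_Cons: "reduced (x # w) \<longleftrightarrow> (w = [] \<or> hd w \<noteq> linv x) \<and> reduced w"
  by (auto simp: reduced_def successively_Cons)

lemma reduced_append:
  "reduced (u @ v) \<longleftrightarrow>
     reduced u \<and> reduced v \<and> (u = [] \<or> v = [] \<or> hd v \<noteq> linv (last u))"
  by (auto simp: reduced_def successively_append_iff)

lemma reduced_push: "reduced w \<Longrightarrow> reduced (push x w)"
  by (cases w) (auto simp: reduced_Cons)

lemma push_push_linv: "reduced w \<Longrightarrow> push x (push (linv x) w) = w"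
  by (cases w rule: list.exhaust[case_product list.exhaust[of "tl w"]])
     (auto simp: reduced_Cons)

lemma reduced_foldr_push: "reduced w \<Longrightarrow> reduced (foldr push u w)"
  by (induction u) (auto simp: reduced_push)

lemma reduced_reduce: "reduced (reduce w)"
  by (simp add: reduce_def reduced_foldr_push)

lemma reduce_reduced: "reduced w \<Longrightarrow> reduce w = w"
proof (induction w)
  case (Cons x w)
  then have "reduce w = w" by (simp add: reduced_Cons)
  then show ?case
    using Cons.prems by (cases w) (auto simp: reduce_def reduced_Cons)
qed (simp add: reduce_def)

lemma set_push: "set (push x w) \<subseteq> insert x (set w)"
  by (cases w) auto

lemma set_reduce: "set (reduce w) \<subseteq> set w"
proof (induction w)
  case (Cons x w)
  then show ?case using set_push[of x "reduce w"] by (auto simp: reduce_def)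
qed (simp add: reduce_def)

lemma foldr_push_push:
  assumes "reduced z" shows "foldr push (push x w) z = push x (foldr push w z)"
proof (cases w)
  case (Cons y ys)
  then show ?thesis
    using push_push_linv[OF reduced_foldr_push[OF assms, of ys], of x] by simp
qed simp

lemma foldr_push_reduce:
  assumes "reduced z" shows "foldr push (reduce u) z = foldr push u z"
proof (induction u)
  case (Cons x u)
  then show ?case using foldr_push_push[OF assms, of x "reduce u"] by (simp add: reduce_def)
qed (simp add: reduce_def)

lemma reduce_append: "reduce (u @ v) = foldr push u (reduce v)"
  by (simp add: reduce_def)

lemma reduced_winv: "reduced w \<Longrightarrow> reduced (winv w)"
proof (induction w)
  case (Cons x w)
  then show ?case by (auto simp: winv_def reduced_append reduced_Cons last_rev hd_map)
qed (simp add: winv_def)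

lemma reduce_winv_append: "reduced w \<Longrightarrow> reduce (winv w @ w) = []"
proof (induction w)
  case (Cons x w)
  then have "reduced w" by (simp add: reduced_Cons)
  then have "push (linv x) (push x w) = w"
    using push_push_linv[of w "linv x"] by simp
  moreover have "reduce (x # w) = push x w"
    using reduce_reduced[OF \<open>reduced w\<close>] by (simp add: reduce_def)
  ultimately have "reduce (linv x # x # w) = reduce w"
    using reduce_reduced[OF \<open>reduced w\<close>] by (simp add: reduce_def)
  then show ?case
    using Cons.IH[OF \<open>reduced w\<close>] by (simp add: winv_def reduce_append)
qed (simp add: winv_def reduce_def)

lemma group_free_group: "group (free_group k)"
proof (rule groupI)
  fix u v w
  assume uvw: "u \<in> carrier (free_group k)" "v \<in> carrier (free_group k)"
    "w \<in> carrier (free_group k)"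
  show "u \<otimes>\<^bsub>free_group k\<^esub> v \<in> carrier (free_group k)"
    using uvw set_reduce[of "u @ v"] by (auto simp: free_group_def reduced_reduce)
  have "reduced w" using uvw by (simp add: free_group_def)
  then show "u \<otimes>\<^bsub>free_group k\<^esub> v \<otimes>\<^bsub>free_group k\<^esub> w = u \<otimes>\<^bsub>free_group k\<^esub> (v \<otimes>\<^bsub>free_group k\<^esub> w)"
    by (simp add: free_group_def reduce_append[of "reduce _"] reduce_append[of u "reduce _"]
        reduce_reduced reduced_reduce foldr_push_reduce)
       (simp add: reduce_append reduce_reduced)
next
  fix u assume u: "u \<in> carrier (free_group k)"
  then show "\<one>\<^bsub>free_group k\<^esub> \<otimes>\<^bsub>free_group k\<^esub> u = u"
    by (simp add: free_group_def reduce_reduced)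
  have "winv u \<in> carrier (free_group k)"
    using u by (auto simp: free_group_def reduced_winv) (auto simp: winv_def)
  then show "\<exists>v\<in>carrier (free_group k). v \<otimes>\<^bsub>free_group k\<^esub> u = \<one>\<^bsub>free_group k\<^esub>"
    using u by (intro bexI[of _ "winv u"]) (auto simp: free_group_def reduce_winv_append)
qed (simp add: free_group_def)

section \<open>Cyclically reduced words\<close>

definition cyc_reduced :: "letter list \<Rightarrow> bool" where
  "cyc_reduced w \<longleftrightarrow> (\<forall>n. reduced (rotate n w))"

definition cyc_reduced_words :: "nat \<Rightarrow> letter list set" where
  "cyc_reduced_words k = {w. set w \<subseteq> letters k \<and> cyc_reduced w}"

definition cyc_form :: "letter list \<Rightarrow> letter list" where
  "cyc_form w = (THE u. cyc_reduced u \<and> (\<exists>v. w = v @ u @ winv v))"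

definition cyc_length :: "letter list \<Rightarrow> nat" where
  "cyc_length w = length (cyc_form w)"

lemma cyc_reduced_imp_reduced: "cyc_reduced w \<Longrightarrow> reduced w"
  unfolding cyc_reduced_def by (metis rotate0 id_apply)

lemma not_cyc_reduced: "\<not> cyc_reduced (x # w @ [linv x])"
proof
  assume "cyc_reduced (x # w @ [linv x])"
  then have "reduced (rotate 1 (x # w @ [linv x]))" unfolding cyc_reduced_def by blast
  then show False by (simp add: reduced_append reduced_Cons)
qed

lemma cyc_reducedI:
  assumes "reduced w" "w = [] \<or> hd w \<noteq> linv (last w)"
  shows "cyc_reduced w"
  unfolding cyc_reduced_def
proof
  fix n
  let ?m = "n mod length w"
  have "reduced (take ?m w @ drop ?m w)" using assms by simp
  then have "reduced (take ?m w)" "reduced (drop ?m w)"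
    unfolding reduced_append by blast+
  then show "reduced (rotate n w)"
    using assms(2) by (cases "?m = 0")
      (auto simp: rotate_drop_take reduced_append hd_take last_drop)
qed

lemma cyc_form_exists: "reduced w \<Longrightarrow> \<exists>u v. cyc_reduced u \<and> w = v @ u @ winv v"
proof (induction "length w" arbitrary: w rule: less_induct)
  case less
  show ?case
  proof (cases "w = [] \<or> hd w \<noteq> linv (last w)")
    case True
    then show ?thesis
      using cyc_reducedI[OF less.prems] by (intro exI[of _ w] exI[of _ "[]"]) (simp add: winv_def)
  next
    case False
    then obtain x w' where w: "w = x # w'" by (cases w) auto
    with False have "w' \<noteq> []" by auto
    then obtain w'' y where "w' = w'' @ [y]" by (cases w' rule: rev_cases) auto
    with False w have w'': "w = x # w'' @ [linv x]" by simp
    then have "reduced w''" using less.prems by (simp add: reduced_Cons reduced_append)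
    then obtain u v where "cyc_reduced u" "w'' = v @ u @ winv v"
      using less.hyps[of w''] w'' by auto
    then show ?thesis
      using w'' by (intro exI[of _ u] exI[of _ "x # v"]) (simp add: winv_def)
  qed
qed

lemma cyc_form_unique:
  assumes "cyc_reduced u" "cyc_reduced u'" "v @ u @ winv v = v' @ u' @ winv v'"
  shows "u = u' \<and> v = v'"
  using assms(3)
proof (induction v arbitrary: v')
  case Nil
  then show ?case
    using assms(1) not_cyc_reduced by (cases v') (auto simp: winv_def simp flip: append_assoc)
next
  case (Cons x v)
  then show ?case
    using assms(2) not_cyc_reduced[of x "v @ u @ winv v"]
    by (cases v') (auto simp: winv_def)
qed

lemma cyc_form:
  assumes "reduced w"
  shows "cyc_reduced (cyc_form w)" "\<exists>v. w = v @ cyc_form w @ winv v"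
proof -
  have "\<exists>!u. cyc_reduced u \<and> (\<exists>v. w = v @ u @ winv v)"
    using cyc_form_exists[OF assms] cyc_form_unique by blast
  from theI'[OF this]
  show "cyc_reduced (cyc_form w)" "\<exists>v. w = v @ cyc_form w @ winv v"
    unfolding cyc_form_def by blast+
qed

section \<open>Automorphisms and strictly minimal elements\<close>

text \<open>\<^const>\<open>auto\<close> is the set of automorphisms of a group, as functions extensional on the
  carrier.\<close>

definition aut_orbit :: "nat \<Rightarrow> letter list \<Rightarrow> letter list set" where
  "aut_orbit k w = (\<lambda>\<phi>. \<phi> w) ` auto (free_group k)"

definition inner_aut :: "nat \<Rightarrow> (letter list \<Rightarrow> letter list) \<Rightarrow> bool" where
  "inner_aut k \<tau> \<longleftrightarrow> \<tau> \<in> auto (free_group k) \<and>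
     (\<exists>g\<in>carrier (free_group k). \<forall>x\<in>carrier (free_group k).
        \<tau> x = g \<otimes>\<^bsub>free_group k\<^esub> x \<otimes>\<^bsub>free_group k\<^esub> inv\<^bsub>free_group k\<^esub> g)"

definition whitehead2 :: "nat \<Rightarrow> (letter list \<Rightarrow> letter list) \<Rightarrow> bool" where
  "whitehead2 k \<tau> \<longleftrightarrow> \<tau> \<in> auto (free_group k) \<and>
     (\<exists>a\<in>letters k. \<forall>x\<in>letters k.
        \<tau> [x] \<in> {[x],
                 [x] \<otimes>\<^bsub>free_group k\<^esub> [a],
                 inv\<^bsub>free_group k\<^esub> [a] \<otimes>\<^bsub>free_group k\<^esub> [x],
                 inv\<^bsub>free_group k\<^esub> [a] \<otimes>\<^bsub>free_group k\<^esub> [x] \<otimes>\<^bsub>free_group k\<^esub> [a]})"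

definition SM :: "nat \<Rightarrow> letter list set" where
  "SM k = {w \<in> cyc_reduced_words k.
             \<forall>\<tau>. whitehead2 k \<tau> \<and> \<not> inner_aut k \<tau> \<longrightarrow> cyc_length (\<tau> w) > length w}"

definition SM' :: "nat \<Rightarrow> letter list set" where
  "SM' k = {w \<in> carrier (free_group k). cyc_form w \<in> SM k}"

section \<open>Growth and genericity\<close>

definition rho :: "nat \<Rightarrow> 'a list set \<Rightarrow> nat" where
  "rho n S = card {w \<in> S. length w \<le> n}"

definition converges_exp_fast :: "(nat \<Rightarrow> real) \<Rightarrow> real \<Rightarrow> bool" where
  "converges_exp_fast x L \<longleftrightarrow> x \<longlonglongrightarrow> L \<and>
     (\<exists>\<sigma> K. 0 < \<sigma> \<and> \<sigma> < 1 \<and> K > 0 \<and> (\<forall>n\<ge>1. \<bar>L - x n\<bar> \<le> K * \<sigma> ^ n))"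

definition exp_generic :: "'a list set \<Rightarrow> 'a list set \<Rightarrow> bool" where
  "exp_generic B S \<longleftrightarrow> B \<subseteq> S \<and> converges_exp_fast (\<lambda>n. real (rho n B) / real (rho n S)) 1"

definition exp_negligible :: "'a list set \<Rightarrow> 'a list set \<Rightarrow> bool" where
  "exp_negligible B S \<longleftrightarrow> B \<subseteq> S \<and> exp_generic (S - B) S"

definition growth_rate :: "'a list set \<Rightarrow> ereal" where
  "growth_rate S = limsup (\<lambda>n. ereal (root n (real (rho n S))))"

end

theory Submission
  imports Defs "Jordan_Normal_Form.Determinant" "HOL-Analysis.Extended_Real_Limits"
begin

text \<open>The orbit of \<open>w\<close> splits into the part outside \<open>SM' k\<close> and the part inside. Outside, it is enough
  that \<open>SM' k\<close> has an exponentially negligible complement (\<open>rho_not_SM'\<close>). Inside, all members of the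
  orbit have the same cyclic length, because a strictly minimal word is a shortest word of its orbit
  up to conjugacy (\<open>cut_minimal_shortest\<close>). So they are conjugates \<open>v u v\<^sup>-\<^sup>1\<close> with \<open>u\<close> from a finite set,
  and replacing \<open>u\<close> by a single letter maps them, with bounded multiplicity, to words that are not in
  \<open>SM' k\<close> (\<open>rho_aut_orbit\<close>). Hence the orbit grows at most like a constant times the complement of
  \<open>SM' k\<close>, which gives all four claims, the lower bound for the ambient sets being elementary
  (\<open>rho_cyc_reduced_ge\<close>).

  The step from locally shortest to shortest is Whitehead's theorem. It is derived here from cuts of the
  Cayley tree instead of peak reduction. Given an automorphism \<open>\<phi>\<close>, every generator \<open>j\<close> yields the
  set of those \<open>g\<close> for which \<open>\<phi> g\<close> starts with \<open>j\<close>; this set has a finite boundary, and the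
  translates of a path \<open>U\<close> cross these sets at most \<open>length (\<phi> U)\<close> times in total
  (\<open>card_crossings_basis_cut\<close>). On the other hand, take any cut with finite boundary that separates the
  two ends of the axis of a generator \<open>x\<close>. Pruning it from outside towards the root, where each
  pruning step follows the straight continuation of a vertex, does not increase the number of crossings
  with powers of \<open>u\<close> beyond a bounded error, exactly because \<open>u\<close> cannot be shortened by a Whitehead
  automorphism. What remains is a cut of the star of one vertex that separates \<open>x\<close> from its inverse,
  and minimality once more bounds its crossings below by the number of occurrences of \<open>x\<close> in the power
  (\<open>gen_count_le_crossings\<close>). Since \<open>\<phi>\<close> is invertible on the abelianization, some permutation pairs
  each \<open>j\<close> with a generator whose axis is separated by the cut of \<open>j\<close> (\<open>expsum_permutation\<close>), and
  summing over \<open>j\<close> gives \<open>length u \<le> cyc_length (\<phi> u)\<close>.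

  For the genericity of \<open>SM k\<close>, the change of length under a Whitehead automorphism is an exact sum over
  pairs of consecutive letters (\<open>cyc_length_wh\<close>). In a random reduced word all pairs are equally likely,
  and the mean of the summand is positive unless the automorphism is inner (\<open>straddle_total\<close>). An
  exponential moment estimate for the Markov chain of letters then shows that words with a small sum are
  exponentially rare (\<open>large_deviations\<close>).\<close>

section \<open>Calculations in the free group\<close>

lemma reduce_reduce [simp]: "reduce (reduce u) = reduce u"
  by (simp add: reduce_reduced reduced_reduce)

lemma reduce_reduce_append [simp]: "reduce (reduce u @ v) = reduce (u @ v)"
  by (simp add: reduce_append foldr_push_reduce reduced_reduce)

lemma reduce_append_reduce [simp]: "reduce (u @ reduce v) = reduce (u @ v)"
  by (simp add: reduce_append)

lemma reduce_mid [simp]: "reduce (u @ reduce v @ w) = reduce (u @ v @ w)"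
  by (metis reduce_append_reduce reduce_reduce_append)

lemma reduce_mid2 [simp]: "reduce (u @ v @ reduce w) = reduce (u @ v @ w)"
  "reduce (u @ v @ w @ reduce z) = reduce (u @ v @ w @ z)"
  using reduce_append_reduce[of "u @ v" w] reduce_append_reduce[of "u @ v @ w" z] by simp_all

lemma reduce_Cons_reduce [simp]: "reduce (x # reduce u) = reduce (x # u)"
  using reduce_append_reduce[of "[x]" u] by simp

lemma reduce_Nil [simp]: "reduce [] = []"
  by (simp add: reduce_def)

lemma reduce_single [simp]: "reduce [x] = [x]"
  by (simp add: reduce_def)

lemma reduce_cancel [simp]: "reduce (u @ x # linv x # v) = reduce (u @ v)"
proof -
  have "reduce (x # linv x # v) = reduce v"
    using push_push_linv[OF reduced_reduce, of x v] by (simp add: reduce_def)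
  then show ?thesis by (metis reduce_append_reduce)
qed

lemma reduce_cancel' [simp]: "reduce (u @ linv x # x # v) = reduce (u @ v)"
  using reduce_cancel[of u "linv x" v] by simp

lemma reduce_cancel_Cons [simp]: "reduce (x # linv x # v) = reduce v" "reduce (linv x # x # v) = reduce v"
  using reduce_cancel[of "[]" x v] reduce_cancel'[of "[]" x v] by simp_all

lemma winv_simps [simp]:
  "winv [] = []" "winv (x # u) = winv u @ [linv x]" "winv (u @ v) = winv v @ winv u"
  "winv (winv u) = u" "length (winv u) = length u" "winv u = [] \<longleftrightarrow> u = []"
  by (auto simp: winv_def rev_map o_def)

lemma set_winv_letters [simp]: "set (winv u) \<subseteq> letters k \<longleftrightarrow> set u \<subseteq> letters k"
  by (auto simp: winv_def)

lemma hd_winv: "u \<noteq> [] \<Longrightarrow> hd (winv u) = linv (last u)"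
  and last_winv: "u \<noteq> [] \<Longrightarrow> last (winv u) = linv (hd u)"
  by (simp_all add: winv_def hd_rev last_rev last_map hd_map)

lemma reduced_winv_iff [simp]: "reduced (winv u) \<longleftrightarrow> reduced u"
  by (metis reduced_winv winv_simps(4))

lemma reduce_winv_cancel [simp]: "reduce (u @ w @ winv w @ v) = reduce (u @ v)"
proof -
  have "reduce (w @ winv w @ v) = reduce v"
  proof (induction w arbitrary: v)
    case (Cons x w)
    have "reduce ((x # w) @ winv (x # w) @ v) = reduce (x # reduce (w @ winv w @ linv x # v))"
      by simp
    also have "\<dots> = reduce v"
      unfolding Cons by simp
    finally show ?case .
  qed simp
  then show ?thesis by (simp only: reduce_append[of u])
qed

lemma reduce_winv_cancel_simps [simp]:
  "reduce (u @ winv w @ w @ v) = reduce (u @ v)"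
  "reduce (w @ winv w @ v) = reduce v" "reduce (winv w @ w @ v) = reduce v"
  "reduce (u @ w @ winv w) = reduce u" "reduce (u @ winv w @ w) = reduce u"
  "reduce (w @ winv w) = []" "reduce (winv w @ w) = []"
  using reduce_winv_cancel[of u "winv w" v] reduce_winv_cancel[of "[]" w v]
    reduce_winv_cancel[of "[]" "winv w" v] reduce_winv_cancel[of u w "[]"]
    reduce_winv_cancel[of u "winv w" "[]"] reduce_winv_cancel[of "[]" w "[]"]
    reduce_winv_cancel[of "[]" "winv w" "[]"] by simp_all

lemma length_reduce: "length (reduce u) \<le> length u"
proof (induction u)
  case (Cons x u)
  have "length (push x v) \<le> Suc (length v)" for v by (cases v) auto
  from this[of "reduce u"] Cons show ?case by (simp add: reduce_def)
qed simp

lemma winv_reduce: "winv (reduce u) = reduce (winv u)"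
proof -
  have "reduce (winv (reduce u)) = reduce (winv u @ u @ winv (reduce u))" by simp
  also have "\<dots> = reduce (winv u @ reduce u @ winv (reduce u))" by (simp only: reduce_mid)
  also have "\<dots> = reduce (winv u)" by (simp only: reduce_winv_cancel_simps)
  finally show ?thesis by (simp add: reduce_reduced reduced_reduce)
qed

lemma in_carrier: "w \<in> carrier (free_group k) \<longleftrightarrow> set w \<subseteq> letters k \<and> reduced w"
  by (simp add: free_group_def)

lemma mult_free [simp]: "u \<otimes>\<^bsub>free_group k\<^esub> v = reduce (u @ v)"
  and one_free [simp]: "\<one>\<^bsub>free_group k\<^esub> = []"
  by (simp_all add: free_group_def)

lemma reduce_in_carrier: "set u \<subseteq> letters k \<Longrightarrow> reduce u \<in> carrier (free_group k)"
  using set_reduce[of u] by (auto simp: in_carrier reduced_reduce)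

lemma inv_free [simp]: "u \<in> carrier (free_group k) \<Longrightarrow> inv\<^bsub>free_group k\<^esub> u = winv u"
  by (rule group.inv_equality[OF group_free_group]) (simp_all add: in_carrier)

lemma single_in_carrier [simp]: "[x] \<in> carrier (free_group k) \<longleftrightarrow> x \<in> letters k"
  by (simp add: in_carrier reduced_Cons)

lemma Nil_in_carrier [simp]: "[] \<in> carrier (free_group k)"
  by (simp add: in_carrier)

text \<open>Cancellation goes on letter by letter until the first pair that does not cancel; what is left on
  both sides is again reduced.\<close>

lemma cancellation:
  assumes "reduced g" "reduced u"
  obtains i s where "i \<le> length u" "g = s @ winv (take i u)" "reduce (g @ u) = s @ drop i u"
proof -
  have "\<exists>i s. i \<le> length u \<and> g = s @ winv (take i u) \<and> reduce (g @ u) = s @ drop i u"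
    using assms
  proof (induction u arbitrary: g)
    case Nil
    then show ?case by (simp add: reduce_reduced)
  next
    case (Cons c u)
    show ?case
    proof (cases "g \<noteq> [] \<and> last g = linv c")
      case True
      then obtain g' where g: "g = g' @ [linv c]" by (metis append_butlast_last_id)
      then have "reduced g'" "reduced u" using Cons.prems by (simp_all add: reduced_append reduced_Cons)
      from Cons.IH[OF this] obtain i s where
        "i \<le> length u" "g' = s @ winv (take i u)" "reduce (g' @ u) = s @ drop i u" by blast
      moreover have "reduce (g @ c # u) = reduce (g' @ u)"
        using reduce_cancel'[of g' c u] g by simp
      ultimately show ?thesis using g
        by (intro exI[of _ "Suc i"] exI[of _ s]) (simp del: append_assoc add: append_assoc[symmetric])
    next
      case False
      then have "reduced (g @ c # u)" using Cons.prems by (auto simp: reduced_append)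
      then show ?thesis by (intro exI[of _ 0] exI[of _ g]) (simp add: reduce_reduced)
    qed
  qed
  then show thesis using that by blast
qed

section \<open>Powers and cyclic length\<close>

abbreviation wpow :: "letter list \<Rightarrow> nat \<Rightarrow> letter list" where
  "wpow u n \<equiv> concat (replicate n u)"

lemma wpow_Suc2: "wpow u (Suc n) = wpow u n @ u"
  by (induction n) auto

lemma length_wpow [simp]: "length (wpow u n) = n * length u"
  by (induction n) auto

lemma set_wpow: "set (wpow u n) \<subseteq> set u"
  by (induction n) auto

lemma cyc_reduced_iff: "cyc_reduced w \<longleftrightarrow> reduced w \<and> (w = [] \<or> hd w \<noteq> linv (last w))"
proof
  assume c: "cyc_reduced w"
  have "hd w \<noteq> linv (last w)" if ne: "w \<noteq> []"
  proof
    assume h: "hd w = linv (last w)"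
    obtain x w' where w: "w = x # w'" using ne by (meson neq_Nil_conv)
    then have "w' \<noteq> []" using h by auto
    then obtain w'' y where "w' = w'' @ [y]" by (cases w' rule: rev_cases) auto
    then have "w = x # w'' @ [linv x]" using w h by auto
    then show False using not_cyc_reduced c by blast
  qed
  then show "reduced w \<and> (w = [] \<or> hd w \<noteq> linv (last w))"
    using cyc_reduced_imp_reduced[OF c] by blast
qed (auto intro: cyc_reducedI)

lemma hd_wpow: "n > 0 \<Longrightarrow> u \<noteq> [] \<Longrightarrow> hd (wpow u n) = hd u"
  by (cases n) auto

lemma last_wpow: "n > 0 \<Longrightarrow> u \<noteq> [] \<Longrightarrow> last (wpow u n) = last u"
  by (cases n) (simp_all only: wpow_Suc2 last_appendR, simp)

lemma reduced_wpow: "cyc_reduced u \<Longrightarrow> reduced (wpow u n)"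
proof (induction n)
  case (Suc n)
  then show ?case
    by (cases "n = 0 \<or> u = []") (auto simp: cyc_reduced_iff reduced_append hd_wpow)
qed simp

lemma cyc_form_eqI: "cyc_reduced u \<Longrightarrow> cyc_form (v @ u @ winv v) = u"
  unfolding cyc_form_def using cyc_form_unique by blast

lemma cyc_length_cyc_reduced: "cyc_reduced u \<Longrightarrow> cyc_length u = length u"
  using cyc_form_eqI[of u "[]"] by (simp add: cyc_length_def)

lemma reduced_conj_wpow:
  assumes "reduced (v @ u @ winv v)" "cyc_reduced u" "u \<noteq> []" "n > 0"
  shows "reduced (v @ wpow u n @ winv v)"
  using assms reduced_wpow[of u n]
  by (cases v rule: rev_cases) (auto simp: reduced_append reduced_Cons hd_wpow last_wpow)

lemma reduce_wpow_conj: "reduce (wpow (v @ u @ winv v) n) = reduce (v @ wpow u n @ winv v)"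
proof (induction n)
  case (Suc n)
  have "reduce (wpow (v @ u @ winv v) (Suc n)) = reduce ((v @ u @ winv v) @ reduce (wpow (v @ u @ winv v) n))"
    by simp
  also have "\<dots> = reduce ((v @ u) @ winv v @ v @ wpow u n @ winv v)"
    unfolding Suc by simp
  also have "\<dots> = reduce (v @ wpow u (Suc n) @ winv v)"
    by (subst reduce_winv_cancel_simps(1)) simp
  finally show ?case .
qed simp

text \<open>The conjugating part of \<open>w\<close> survives once at each end of a power, however high the power is. So the
  cyclic length is the growth rate of the lengths of the powers.\<close>

lemma length_reduce_wpow:
  assumes "reduced w"
  obtains c where "\<And>n. n > 0 \<Longrightarrow> length (reduce (wpow w n)) = n * cyc_length w + c"
proof -
  obtain v where v: "w = v @ cyc_form w @ winv v" and c: "cyc_reduced (cyc_form w)"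
    using cyc_form[OF assms] by blast
  show thesis
  proof (cases "cyc_form w = []")
    case True
    then have "w = []" using v assms
      by (cases v rule: rev_cases) (auto simp: reduced_append reduced_Cons)
    then show ?thesis using that[of 0] True by (simp add: cyc_length_def)
  next
    case False
    have "length (reduce (wpow w n)) = n * cyc_length w + 2 * length v" if "n > 0" for n
    proof -
      have "reduce (wpow w n) = reduce (v @ wpow (cyc_form w) n @ winv v)"
        by (subst v) (rule reduce_wpow_conj)
      also have "\<dots> = v @ wpow (cyc_form w) n @ winv v"
        using reduced_conj_wpow[OF _ c False that] v assms by (simp add: reduce_reduced)
      finally show ?thesis by (simp add: cyc_length_def)
    qed
    then show ?thesis using that by blast
  qed
qed

lemma linear_bound_imp_le:
  fixes a b c :: nat
  assumes "\<And>n. n > 0 \<Longrightarrow> n * a \<le> n * b + c"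
  shows "a \<le> b"
proof (rule ccontr)
  assume "\<not> a \<le> b"
  then have "(c + 1) * (b + 1) \<le> (c + 1) * a" by (intro mult_le_mono2) simp
  then show False using assms[of "c + 1"] by simp
qed

text \<open>Conjugation changes the length of every power by at most \<open>2 * length g\<close>, which the growth rate
  does not see.\<close>

lemma cyc_length_conj_le:
  assumes "reduced w"
  shows "cyc_length (reduce (g @ w @ winv g)) \<le> cyc_length w"
proof -
  let ?w = "reduce (g @ w @ winv g)"
  obtain c where c: "\<And>n. n > 0 \<Longrightarrow> length (reduce (wpow w n)) = n * cyc_length w + c"
    using length_reduce_wpow[OF assms] by blast
  obtain d where d: "\<And>n. n > 0 \<Longrightarrow> length (reduce (wpow ?w n)) = n * cyc_length ?w + d"
    using length_reduce_wpow[OF reduced_reduce] by blast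
  have wp: "reduce (wpow (reduce x) n) = reduce (wpow x n)" for x n
    by (induction n) (simp_all, metis reduce_append_reduce)
  have "n * cyc_length ?w \<le> n * cyc_length w + (c + 2 * length g)" if "n > 0" for n
  proof -
    have "reduce (wpow ?w n) = reduce (g @ reduce (wpow w n) @ winv g)"
      by (simp add: wp reduce_wpow_conj)
    then have "length (reduce (wpow ?w n)) \<le> length (g @ reduce (wpow w n) @ winv g)"
      by (metis length_reduce)
    then show ?thesis using c[OF that] d[OF that] by simp
  qed
  then show ?thesis by (rule linear_bound_imp_le)
qed

lemma cyc_length_conj:
  assumes "reduced w"
  shows "cyc_length (reduce (g @ w @ winv g)) = cyc_length w"
proof (rule antisym)
  have "w = reduce (winv g @ reduce (g @ w @ winv g) @ winv (winv g))"
    using assms reduce_winv_cancel_simps(5)[of w g] by (simp add: reduce_reduced)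
  then show "cyc_length w \<le> cyc_length (reduce (g @ w @ winv g))"
    by (metis cyc_length_conj_le reduced_reduce)
qed (rule cyc_length_conj_le[OF assms])

section \<open>Homomorphisms of the free group\<close>

lemma reduce_wpow_reduce: "reduce (wpow (reduce w) n) = reduce (wpow w n)"
proof (induction n)
  case (Suc n)
  have "reduce (wpow (reduce w) (Suc n)) = reduce (reduce w @ reduce (wpow (reduce w) n))" by simp
  then show ?case unfolding Suc by simp
qed simp

definition subst :: "(letter \<Rightarrow> letter list) \<Rightarrow> letter list \<Rightarrow> letter list" where
  "subst f w = reduce (concat (map f w))"

lemma subst_simps [simp]:
  "subst f [] = []" "subst f (x # w) = reduce (f x @ subst f w)"
  "subst f (u @ v) = reduce (subst f u @ subst f v)" "reduce (subst f u) = subst f u"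
  by (simp_all add: subst_def)

text \<open>This is the condition under which a substitution of letters respects free reduction.\<close>

definition inv_compatible :: "(letter \<Rightarrow> letter list) \<Rightarrow> bool" where
  "inv_compatible f \<longleftrightarrow> (\<forall>x. f (linv x) = winv (f x))"

lemma subst_reduce:
  assumes "inv_compatible f"
  shows "subst f (reduce w) = subst f w"
proof (induction w)
  case (Cons x w)
  have "subst f (push x v) = subst f (x # v)" for v
    using assms[unfolded inv_compatible_def, rule_format, of x]
    by (cases v) (auto simp del: split_paired_All)
  from this[of "reduce w"] have "subst f (reduce (x # w)) = subst f (x # reduce w)"
    by (simp add: reduce_def)
  then show ?case using Cons by simp
qed simp

lemma subst_closed: "(\<And>x. x \<in> letters k \<Longrightarrow> set (f x) \<subseteq> letters k) \<Longrightarrow> set w \<subseteq> letters k \<Longrightarrow>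
    subst f w \<in> carrier (free_group k)"
  unfolding subst_def by (rule reduce_in_carrier) auto

lemma subst_subst:
  assumes f: "inv_compatible f"
    and id: "\<And>x. x \<in> letters k \<Longrightarrow> subst f (g x) = [x]" and w: "set w \<subseteq> letters k"
  shows "subst f (subst g w) = reduce w"
proof -
  have "subst f (subst g w) = subst f (concat (map g w))"
    unfolding subst_def[of g] by (rule subst_reduce[OF f])
  also have "\<dots> = reduce w"
    using w id by (induction w) simp_all
  finally show ?thesis .
qed

text \<open>The universal property of the free group: to be inverse to each other, two substitutions need only
  be so on the letters.\<close>

lemma subst_auto:
  assumes f: "inv_compatible f" "\<And>x. x \<in> letters k \<Longrightarrow> set (f x) \<subseteq> letters k"
    and g: "inv_compatible g" "\<And>x. x \<in> letters k \<Longrightarrow> set (g x) \<subseteq> letters k"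
    and fg: "\<And>x. x \<in> letters k \<Longrightarrow> subst f (g x) = [x]"
    and gf: "\<And>x. x \<in> letters k \<Longrightarrow> subst g (f x) = [x]"
  shows "restrict (subst f) (carrier (free_group k)) \<in> auto (free_group k)"
proof -
  let ?F = "carrier (free_group k)"
  have "bij_betw (subst f) ?F ?F"
  proof (rule bij_betw_byWitness[where f' = "subst g"])
    show "\<forall>w\<in>?F. subst g (subst f w) = w" "\<forall>w\<in>?F. subst f (subst g w) = w"
      using subst_subst[OF f(1) fg] subst_subst[OF g(1) gf] by (auto simp: in_carrier reduce_reduced)
    show "subst f ` ?F \<subseteq> ?F" "subst g ` ?F \<subseteq> ?F"
      using subst_closed[OF f(2)] subst_closed[OF g(2)] by (auto simp: in_carrier)
  qed
  moreover have "subst f w \<in> ?F" if "w \<in> ?F" for w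
    using that subst_closed[OF f(2)] by (auto simp: in_carrier)
  moreover have "reduce (u @ v) \<in> ?F" if "u \<in> ?F" "v \<in> ?F" for u v
    using that by (intro reduce_in_carrier) (auto simp: in_carrier)
  ultimately show ?thesis
    using subst_reduce[OF f(1)]
    by (auto simp: auto_def hom_def Bij_def bij_betw_restrict_eq)
qed

lemma mult_closed: "u \<in> carrier (free_group k) \<Longrightarrow> v \<in> carrier (free_group k) \<Longrightarrow>
    reduce (u @ v) \<in> carrier (free_group k)"
  by (intro reduce_in_carrier) (auto simp: in_carrier)

lemma winv_closed [simp]: "winv u \<in> carrier (free_group k) \<longleftrightarrow> u \<in> carrier (free_group k)"
  by (simp add: in_carrier)

lemma wpow_closed: "u \<in> carrier (free_group k) \<Longrightarrow> reduce (wpow u n) \<in> carrier (free_group k)"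
  using set_wpow[of n u] by (intro reduce_in_carrier) (auto simp: in_carrier)

context
  fixes k \<phi> assumes \<phi>: "\<phi> \<in> auto (free_group k)"
begin

lemma aut_closed: "u \<in> carrier (free_group k) \<Longrightarrow> \<phi> u \<in> carrier (free_group k)"
  using \<phi> by (auto simp: auto_def hom_def)

lemma aut_reduced: "u \<in> carrier (free_group k) \<Longrightarrow> reduced (\<phi> u)"
  using aut_closed by (simp add: in_carrier)

lemma aut_mult: "u \<in> carrier (free_group k) \<Longrightarrow> v \<in> carrier (free_group k) \<Longrightarrow>
    \<phi> (reduce (u @ v)) = reduce (\<phi> u @ \<phi> v)"
  using \<phi> by (auto simp: auto_def hom_def)

lemma aut_bij: "bij_betw \<phi> (carrier (free_group k)) (carrier (free_group k))"
  using \<phi> by (auto simp: auto_def Bij_def)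

lemma aut_Nil: "\<phi> [] = []"
proof -
  have "\<phi> [] = reduce (\<phi> [] @ \<phi> [])" using aut_mult[of "[]" "[]"] by simp
  then have "reduce (winv (\<phi> []) @ \<phi> []) = reduce (winv (\<phi> []) @ \<phi> [] @ \<phi> [])"
    by (metis reduce_append_reduce)
  then show ?thesis
    using aut_reduced[of "[]"] by (simp add: reduce_reduced)
qed

lemma aut_winv: "u \<in> carrier (free_group k) \<Longrightarrow> \<phi> (winv u) = winv (\<phi> u)"
proof -
  assume u: "u \<in> carrier (free_group k)"
  then have "reduce (\<phi> (winv u) @ \<phi> u) = []"
    using aut_mult[of "winv u" u] by (simp add: aut_Nil)
  then have "reduce (reduce (\<phi> (winv u) @ \<phi> u) @ winv (\<phi> u)) = winv (\<phi> u)"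
    using aut_reduced[OF u] by (simp add: reduce_reduced)
  then show ?thesis using aut_reduced[of "winv u"] u by (simp add: reduce_reduced)
qed

lemma aut_subst:
  "set w \<subseteq> letters k \<Longrightarrow> \<phi> (reduce w) = subst (\<lambda>x. \<phi> [x]) w"
proof (induction w)
  case (Cons x w)
  then show ?case
    using aut_mult[of "[x]" "reduce w"] by (simp add: reduce_in_carrier)
qed (simp add: aut_Nil)

lemma aut_subst_carrier:
  "w \<in> carrier (free_group k) \<Longrightarrow> \<phi> w = subst (\<lambda>x. \<phi> [x]) w"
  using aut_subst[of w] by (simp add: in_carrier reduce_reduced)

lemma aut_wpow: "w \<in> carrier (free_group k) \<Longrightarrow>
    \<phi> (reduce (wpow w n)) = reduce (wpow (\<phi> w) n)"
proof (induction n)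
  case (Suc n)
  then show ?case
    using aut_mult[of w "reduce (wpow w n)"] by (simp add: wpow_closed)
qed (simp add: aut_Nil)

lemma aut_conj: "g \<in> carrier (free_group k) \<Longrightarrow> w \<in> carrier (free_group k) \<Longrightarrow>
    \<phi> (reduce (g @ w @ winv g)) = reduce (\<phi> g @ \<phi> w @ winv (\<phi> g))"
  using aut_mult[of g "reduce (w @ winv g)"] aut_mult[of w "winv g"]
  by (simp add: mult_closed aut_winv)

lemma aut_inv_into:
  "restrict (inv_into (carrier (free_group k)) \<phi>) (carrier (free_group k)) \<in> auto (free_group k)"
  using \<phi> group.restrict_inv_into_hom[OF group_free_group] restrict_inv_into_Bij
  by (auto simp: auto_def)

end

section \<open>Exponent sums\<close>

definition lsign :: "nat \<Rightarrow> letter \<Rightarrow> int" where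
  "lsign j x = (if fst x = j then if snd x then 1 else -1 else 0)"

definition expsum :: "nat \<Rightarrow> letter list \<Rightarrow> int" where
  "expsum j w = (\<Sum>x\<leftarrow>w. lsign j x)"

lemma lsign_linv [simp]: "lsign j (linv x) = - lsign j x"
  by (simp add: lsign_def linv_def)

lemma expsum_simps [simp]: "expsum j [] = 0" "expsum j (u @ v) = expsum j u + expsum j v"
  "expsum j (x # u) = lsign j x + expsum j u"
  by (simp_all add: expsum_def)

lemma expsum_reduce [simp]: "expsum j (reduce w) = expsum j w"
proof (induction w)
  case (Cons x w)
  have "expsum j (push x v) = expsum j (x # v)" for v
    by (cases v) auto
  from this[of "reduce w"] have "expsum j (reduce (x # w)) = expsum j (x # reduce w)"
    by (simp add: reduce_def)
  then show ?case using Cons by simp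
qed simp

lemma expsum_winv [simp]: "expsum j (winv w) = - expsum j w"
  by (induction w) simp_all

lemma expsum_aut:
  assumes "\<phi> \<in> auto (free_group k)" "w \<in> carrier (free_group k)"
  shows "expsum j (\<phi> w) = (\<Sum>i<k. expsum i w * expsum j (\<phi> [(i, True)]))"
proof -
  have gen: "expsum j (\<phi> [x]) = (\<Sum>i<k. lsign i x * expsum j (\<phi> [(i, True)]))"
    if x: "x \<in> letters k" for x
  proof -
    have i: "[(fst x, True)] \<in> carrier (free_group k)" "fst x < k"
      using x by (auto simp: letters_def mem_Times_iff)
    have "expsum j (\<phi> [x]) = lsign (fst x) x * expsum j (\<phi> [(fst x, True)])"
    proof (cases "snd x")
      case False
      then have "[x] = winv [(fst x, True)]" by (simp add: linv_def prod_eq_iff)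
      then have "\<phi> [x] = winv (\<phi> [(fst x, True)])"
        using aut_winv[OF assms(1) i(1)] by simp
      then show ?thesis using False by (simp add: lsign_def)
    next
      case True
      then have "x = (fst x, True)" by (simp add: prod_eq_iff)
      then show ?thesis using True by (simp add: lsign_def)
    qed
    also have "\<dots> = (\<Sum>i<k. if i = fst x then lsign (fst x) x * expsum j (\<phi> [(fst x, True)]) else 0)"
      using i by simp
    also have "\<dots> = (\<Sum>i<k. lsign i x * expsum j (\<phi> [(i, True)]))"
      by (rule sum.cong) (auto simp: lsign_def)
    finally show ?thesis .
  qed
  have "expsum j (subst (\<lambda>x. \<phi> [x]) w) = (\<Sum>i<k. expsum i w * expsum j (\<phi> [(i, True)]))"
    if "set w \<subseteq> letters k" for w
    using that
  proof (induction w)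
    case (Cons x w)
    then show ?case using gen[of x]
      by (simp add: sum.distrib algebra_simps)
  qed simp
  then show ?thesis using assms by (simp add: aut_subst_carrier[OF assms(1,2)] in_carrier)
qed

text \<open>The action on the abelianization is invertible, so one of the products in the expansion of its
  determinant is nonzero.\<close>

lemma expsum_permutation:
  assumes \<phi>: "\<phi> \<in> auto (free_group k)"
  obtains \<pi> where "\<pi> permutes {0..<k}" "\<And>j. j < k \<Longrightarrow> expsum j (\<phi> [(\<pi> j, True)]) \<noteq> 0"
proof -
  let ?F = "carrier (free_group k)"
  define \<psi> where "\<psi> = restrict (inv_into ?F \<phi>) ?F"
  have \<psi>: "\<psi> \<in> auto (free_group k)" unfolding \<psi>_def by (rule aut_inv_into[OF \<phi>])
  define M where "M = Matrix.mat k k (\<lambda>(j, i). expsum j (\<phi> [(i, True)]))"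
  define N where "N = Matrix.mat k k (\<lambda>(j, i). expsum j (\<psi> [(i, True)]))"
  have "M * N = 1\<^sub>m k"
  proof (rule eq_matI)
    fix j l assume jl: "j < dim_row (1\<^sub>m k)" "l < dim_col (1\<^sub>m k)"
    have l: "[(l, True)] \<in> ?F" using jl by (simp add: letters_def)
    have "\<phi> (\<psi> [(l, True)]) = [(l, True)]"
      using aut_bij[OF \<phi>] l by (simp add: \<psi>_def bij_betw_inv_into_right)
    then have "expsum j [(l, True)] = (\<Sum>i<k. expsum i (\<psi> [(l, True)]) * expsum j (\<phi> [(i, True)]))"
      using expsum_aut[OF \<phi> aut_closed[OF \<psi> l], of j] by simp
    also have "\<dots> = (M * N) $$ (j, l)"
      using jl by (simp add: M_def N_def scalar_prod_def atLeast0LessThan mult.commute)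
    finally show "(M * N) $$ (j, l) = 1\<^sub>m k $$ (j, l)"
      using jl by (auto simp: lsign_def)
  qed (simp_all add: M_def N_def)
  moreover have MN: "M \<in> carrier_mat k k" "N \<in> carrier_mat k k" by (simp_all add: M_def N_def)
  ultimately have "Determinant.det M * Determinant.det N = 1" by (metis det_mult det_one)
  then have "(\<Sum>p\<in>{p. p permutes {0..<k}}. signof p * (\<Prod>i = 0..<k. M $$ (i, p i))) \<noteq> 0"
    using det_def'[OF MN(1)] by auto
  then obtain p where p: "p permutes {0..<k}" "(\<Prod>i = 0..<k. M $$ (i, p i)) \<noteq> 0"
    by (metis (mono_tags, lifting) mem_Collect_eq mult_zero_right sum.neutral)
  have "expsum j (\<phi> [(p j, True)]) \<noteq> 0" if "j < k" for j
  proof -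
    have "p j < k" using permutes_in_image[OF p(1), of j] that by simp
    moreover have "M $$ (j, p j) \<noteq> 0" using p(2) that by simp
    ultimately show ?thesis using that by (simp add: M_def)
  qed
  then show thesis using p(1) that by blast
qed

section \<open>Sums over consecutive letters\<close>

definition pairsum :: "(letter \<Rightarrow> letter \<Rightarrow> 'a::comm_monoid_add) \<Rightarrow> letter list \<Rightarrow> 'a" where
  "pairsum g w = (\<Sum>i<length w - 1. g (w ! i) (w ! Suc i))"

lemma pairsum_simps [simp]: "pairsum g [] = 0" "pairsum g [x] = 0"
  by (simp_all add: pairsum_def)

lemma pairsum_Cons: "w \<noteq> [] \<Longrightarrow> pairsum g (x # w) = g x (hd w) + pairsum g w"
  by (cases w) (simp_all add: pairsum_def sum.lessThan_Suc_shift del: sum.lessThan_Suc)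

lemma pairsum_append:
  "u \<noteq> [] \<Longrightarrow> v \<noteq> [] \<Longrightarrow> pairsum g (u @ v) = pairsum g u + g (last u) (hd v) + pairsum g v"
  by (induction u) (auto simp: pairsum_Cons add.assoc)

lemma pairsum_add: "pairsum (\<lambda>x y. g x y + h x y) w = pairsum g w + pairsum h w"
  by (simp add: pairsum_def sum.distrib)

section \<open>Whitehead automorphisms\<close>

text \<open>For \<open>b \<in> B\<close> and \<open>linv b \<notin> B\<close> this is the Whitehead automorphism with multiplier \<open>linv b\<close>: it
  fixes \<open>b\<close>, and puts \<open>b\<close> in front of each other letter of \<open>B\<close>, hence \<open>linv b\<close> behind the inverse of
  that letter.\<close>

definition wh :: "letter \<Rightarrow> letter set \<Rightarrow> letter \<Rightarrow> letter list" where
  "wh b B x = (if fst x = fst b then [x]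
     else (if x \<in> B then [b] else []) @ [x] @ (if linv x \<in> B then [linv b] else []))"

lemma fst_linv [simp]: "fst (linv x) = fst x"
  by (simp add: linv_def)

lemma fst_eq_iff: "fst x = fst b \<longleftrightarrow> x = b \<or> x = linv b"
  by (auto simp: linv_def prod_eq_iff)

lemma inv_compatible_wh: "inv_compatible (wh b B)"
  by (auto simp: inv_compatible_def wh_def simp del: split_paired_All)

lemma reduce_cancel_deep [simp]:
  "reduce (z # x # linv x # v) = reduce (z # v)" "reduce (z # linv x # x # v) = reduce (z # v)"
  "reduce (z # y # x # linv x # v) = reduce (z # y # v)"
  "reduce (z # y # linv x # x # v) = reduce (z # y # v)"
  using reduce_cancel[of "[z]" x v] reduce_cancel'[of "[z]" x v]
    reduce_cancel[of "[z, y]" x v] reduce_cancel'[of "[z, y]" x v] by simp_all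

lemma wh_inverse: "subst (wh b B) (wh (linv b) B x) = [x]"
  by (auto simp: wh_def)

lemma set_wh: "b \<in> letters k \<Longrightarrow> x \<in> letters k \<Longrightarrow> set (wh b B x) \<subseteq> letters k"
  by (cases "fst x = fst b"; cases "x \<in> B"; cases "linv x \<in> B") (simp_all add: wh_def)

lemma wh_auto:
  assumes "b \<in> letters k"
  shows "restrict (subst (wh b B)) (carrier (free_group k)) \<in> auto (free_group k)"
proof (rule subst_auto[OF inv_compatible_wh _ inv_compatible_wh])
  show "subst (wh b B) (wh (linv b) B x) = [x]" "subst (wh (linv b) B) (wh b B x) = [x]" for x
    using wh_inverse[of b B x] wh_inverse[of "linv b" B x] by simp_all
qed (use assms set_wh in simp_all)

lemma wh_whitehead2:
  assumes "b \<in> letters k"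
  shows "whitehead2 k (restrict (subst (wh b B)) (carrier (free_group k)))"
  unfolding whitehead2_def
proof (intro conjI bexI[of _ "linv b"] ballI)
  fix x assume "x \<in> letters k"
  then show "restrict (subst (wh b B)) (carrier (free_group k)) [x]
    \<in> {[x], [x] \<otimes>\<^bsub>free_group k\<^esub> [linv b],
       inv\<^bsub>free_group k\<^esub> [linv b] \<otimes>\<^bsub>free_group k\<^esub> [x],
       inv\<^bsub>free_group k\<^esub> [linv b] \<otimes>\<^bsub>free_group k\<^esub> [x] \<otimes>\<^bsub>free_group k\<^esub> [linv b]}"
    using assms by (auto simp: wh_def subst_def)
qed (use assms wh_auto in simp_all)

text \<open>Between consecutive letters \<open>x\<close> and \<open>y\<close>, the image of \<open>x\<close> contributes \<open>linv b\<close> if \<open>linv x \<in> B\<close> and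
  the image of \<open>y\<close> contributes \<open>b\<close> if \<open>y \<in> B\<close>; if both do, the two cancel.\<close>

definition turnword :: "letter \<Rightarrow> letter set \<Rightarrow> letter \<Rightarrow> letter \<Rightarrow> letter list" where
  "turnword b B x y = (if linv x \<in> B then if y \<in> B then [] else [linv b]
                       else if y \<in> B then [b] else [])"

text \<open>The letters \<open>b\<close> and \<open>linv b\<close> of the word are dropped: since \<open>b \<in> B\<close> and \<open>linv b \<notin> B\<close>, the turns on
  their two sides already produce them. The last argument is the letter that follows the word.\<close>

fun whword :: "letter \<Rightarrow> letter set \<Rightarrow> letter list \<Rightarrow> letter \<Rightarrow> letter list" where
  "whword b B [] y = []"
| "whword b B (x # u) y =
     (if fst x = fst b then [] else [x]) @ turnword b B x (hd (u @ [y])) @ whword b B u y"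

text \<open>A path that reads \<open>x\<close> and then \<open>y\<close> passes a vertex, coming from the direction \<open>linv x\<close> and leaving in
  the direction \<open>y\<close>; the set \<open>B\<close> is a cut of the star of that vertex.\<close>

definition straddle :: "letter set \<Rightarrow> letter \<Rightarrow> letter \<Rightarrow> int" where
  "straddle B x y = of_bool ((linv x \<in> B) \<noteq> (y \<in> B))"

lemma length_whword: "int (length (whword b B u y)) =
    pairsum (\<lambda>x y. straddle B x y + of_bool (fst x \<noteq> fst b)) (u @ [y])"
  by (induction u) (auto simp: pairsum_Cons straddle_def turnword_def)

context
  fixes b B assumes bB: "b \<in> B" "linv b \<notin> B"
begin

lemma subst_wh_whword:
  "subst (wh b B) u = reduce ((if hd (u @ [y]) \<in> B then [b] else []) @ whword b B u y @
     (if y \<in> B then [linv b] else []))"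
proof (induction u)
  case (Cons x u)
  have "reduce (wh b B x @ (if h \<in> B then [b] else []) @ R) =
      reduce ((if x \<in> B then [b] else []) @ (if fst x = fst b then [] else [x]) @
        turnword b B x h @ R)" for h R
    using bB by (auto simp: wh_def turnword_def fst_eq_iff)
  then show ?case
    unfolding subst_simps(2) Cons by simp
qed (use bB in simp)

lemma whword_append: "v \<noteq> [] \<Longrightarrow> whword b B (u @ v) y = whword b B u (hd v) @ whword b B v y"
  by (induction u) (auto simp: hd_append)

text \<open>The condition on the first letter makes the induction work: if the next letter of the original word
  is \<open>b\<close>, the new word starts with \<open>b\<close>, or a run of length one has disappeared and a letter outside \<open>B\<close>
  follows. In neither case can it cancel with what precedes it. The letter \<open>linv b\<close> is treated in the same
  way, with \<open>B\<close> replaced by its complement.\<close>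

lemma whword_reduced:
  assumes "reduced (u @ [y])"
  shows "reduced (whword b B u y) \<and> (whword b B u y = [] \<or>
    (if hd (u @ [y]) = b then hd (whword b B u y) = b \<or> hd (whword b B u y) \<notin> insert (linv b) B
     else if hd (u @ [y]) = linv b
       then hd (whword b B u y) = linv b \<or> hd (whword b B u y) \<in> B - {b}
     else hd (whword b B u y) = hd (u @ [y])))"
  using assms
proof (induction u)
  case (Cons x u)
  define h L where "h = hd (u @ [y])" and "L = whword b B u y"
  have "reduced (u @ [y])" "h \<noteq> linv x"
    using Cons.prems by (simp_all add: reduced_Cons h_def)
  then have IH: "reduced L" "L = [] \<or> (if h = b then hd L = b \<or> hd L \<notin> insert (linv b) B
     else if h = linv b then hd L = linv b \<or> hd L \<in> B - {b} else hd L = h)"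
    and hx: "h \<noteq> linv x"
    using Cons.IH by (auto simp: h_def L_def)
  have "whword b B (x # u) y = (if fst x = fst b then [] else [x]) @ turnword b B x h @ L"
    by (simp add: h_def L_def)
  then show ?case
    using IH hx bB unfolding fst_eq_iff
    by (cases "x = b"; cases "x = linv b"; cases "h = b"; cases "h = linv b"; cases "L = []")
       (auto simp: turnword_def reduced_Cons)
qed simp

text \<open>The letters \<open>b\<close> and \<open>linv b\<close> cancel only within the runs of powers of \<open>b\<close>, where \<open>turnword\<close> has
  already carried out the cancellation; hence the change of cyclic length is exact.\<close>

lemma cyc_length_wh:
  assumes u: "cyc_reduced u" "u \<noteq> []"
  shows "int (cyc_length (subst (wh b B) u)) =
    pairsum (\<lambda>x y. straddle B x y + of_bool (fst x \<noteq> fst b)) (u @ [hd u])"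
proof -
  define L where "L = whword b B u (hd u)"
  \<comment> \<open>A word is cyclically reduced as soon as its square is reduced.\<close>
  have "reduced (u @ u @ [hd u])"
    using u by (auto simp: cyc_reduced_iff reduced_append reduced_Cons)
  then have "reduced (whword b B (u @ u) (hd u))"
    using whword_reduced[of "u @ u" "hd u"] by simp
  then have "reduced (L @ L)" by (simp add: L_def whword_append[OF u(2)])
  then have L: "cyc_reduced L" by (auto simp: cyc_reduced_iff reduced_append)
  let ?p = "if hd u \<in> B then [b] else []"
  have "subst (wh b B) u = reduce (?p @ L @ winv ?p)"
    using subst_wh_whword[of u "hd u"] u by (simp add: L_def)
  then have "cyc_length (subst (wh b B) u) = length L"
    using cyc_length_conj[of L ?p] cyc_length_cyc_reduced[OF L] L by (simp add: cyc_reduced_iff)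
  then show ?thesis using length_whword[of b B u "hd u"] by (simp add: L_def)
qed

end

lemma subst_wh_single: "subst (wh b {b}) u = reduce u"
proof (induction u)
  case (Cons x u)
  have "wh b {b} x = [x]" by (auto simp: wh_def)
  then show ?case using Cons by simp
qed simp

text \<open>The cut \<open>{b}\<close> belongs to the identity, so the length formula counts the occurrences of \<open>b\<close> and
  \<open>linv b\<close>.\<close>

lemma pairsum_straddle_single:
  assumes u: "cyc_reduced u" "u \<noteq> []"
  shows "pairsum (\<lambda>x y. straddle {b} x y + of_bool (fst x \<noteq> fst b)) (u @ [hd u]) = int (length u)"
  using cyc_length_wh[of b "{b}" u] u
  by (simp add: subst_wh_single reduce_reduced cyc_reduced_iff cyc_length_cyc_reduced)

lemma inner_cyc_length:
  assumes "inner_aut k \<tau>" "w \<in> carrier (free_group k)"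
  shows "cyc_length (\<tau> w) = cyc_length w"
proof -
  obtain g where g: "g \<in> carrier (free_group k)"
    "\<tau> w = g \<otimes>\<^bsub>free_group k\<^esub> w \<otimes>\<^bsub>free_group k\<^esub> inv\<^bsub>free_group k\<^esub> g"
    using assms unfolding inner_aut_def by blast
  then have "\<tau> w = reduce (g @ w @ winv g)" by simp
  then show ?thesis using cyc_length_conj assms(2) by (simp add: in_carrier)
qed

text \<open>This is minimality under Whitehead automorphisms, expressed by cuts: the edges of the Whitehead graph
  of \<open>u\<close> at the vertex \<open>b\<close> form a minimum cut between \<open>b\<close> and \<open>linv b\<close>.\<close>

definition cut_minimal :: "nat \<Rightarrow> letter list \<Rightarrow> bool" where
  "cut_minimal k u \<longleftrightarrow> (\<forall>b B. b \<in> letters k \<longrightarrow> b \<in> B \<longrightarrow> linv b \<notin> B \<longrightarrow>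
     pairsum (straddle {b}) (u @ [hd u]) \<le> pairsum (straddle B) (u @ [hd u]))"

text \<open>An inner automorphism preserves the cyclic length, so the inequality also holds for those cuts whose
  automorphism is inner.\<close>

lemma SM_cut_minimal:
  assumes "u \<in> SM k" "u \<noteq> []"
  shows "cut_minimal k u"
  unfolding cut_minimal_def
proof (intro allI impI)
  fix b B assume b: "b \<in> letters k" "b \<in> B" "linv b \<notin> B"
  have u: "cyc_reduced u" "u \<in> carrier (free_group k)"
    using assms by (auto simp: SM_def cyc_reduced_words_def in_carrier cyc_reduced_iff)
  let ?\<tau> = "restrict (subst (wh b B)) (carrier (free_group k))"
  have "length u \<le> cyc_length (?\<tau> u)"
  proof (cases "inner_aut k ?\<tau>")
    case True
    then show ?thesis
      using inner_cyc_length[OF True u(2)] cyc_length_cyc_reduced[OF u(1)] by simp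
  next
    case False
    then have "length u < cyc_length (?\<tau> u)"
      using assms(1) wh_whitehead2[OF b(1)] unfolding SM_def by blast
    then show ?thesis by simp
  qed
  then have "int (length u) \<le> int (cyc_length (subst (wh b B) u))" using u by simp
  then show "pairsum (straddle {b}) (u @ [hd u]) \<le> pairsum (straddle B) (u @ [hd u])"
    using cyc_length_wh[OF b(2,3) u(1) assms(2)] pairsum_straddle_single[OF u(1) assms(2), of b]
    by (simp add: pairsum_add)
qed

lemma finite_letters [simp]: "finite (letters k)" and card_letters [simp]: "card (letters k) = 2 * k"
  by (simp_all add: letters_def card_cartesian_product UNIV_bool)

lemma whitehead2_gen:
  assumes "whitehead2 k \<tau>"
  obtains b where "b \<in> letters k"
    "\<And>x. x \<in> letters k \<Longrightarrow> \<tau> [x] \<in> {[x], reduce [x, linv b], reduce [b, x], reduce [b, x, linv b]}"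
proof -
  obtain a where a: "a \<in> letters k" "\<And>x. x \<in> letters k \<Longrightarrow>
      \<tau> [x] \<in> {[x], [x] \<otimes>\<^bsub>free_group k\<^esub> [a], inv\<^bsub>free_group k\<^esub> [a] \<otimes>\<^bsub>free_group k\<^esub> [x],
         inv\<^bsub>free_group k\<^esub> [a] \<otimes>\<^bsub>free_group k\<^esub> [x] \<otimes>\<^bsub>free_group k\<^esub> [a]}"
    using assms unfolding whitehead2_def by blast
  then show thesis using that[of "linv a"] by simp
qed

text \<open>The other words that are possible for the image of \<open>b\<close> are the empty word and \<open>b\<^sup>2\<close>. With such an
  image the automorphism would act on the abelianization with determinant 0 or 2.\<close>

lemma whitehead2_fixes_multiplier:
  assumes \<tau>: "\<tau> \<in> auto (free_group k)" and b: "b \<in> letters k"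
    and opts: "\<And>x. x \<in> letters k \<Longrightarrow>
      \<tau> [x] \<in> {[x], reduce [x, linv b], reduce [b, x], reduce [b, x, linv b]}"
  shows "\<tau> [b] = [b]"
proof -
  define i where "i = fst b"
  have i: "i < k" "(i, True) \<in> letters k" "[b] \<in> carrier (free_group k)"
    using b by (auto simp: i_def letters_def mem_Times_iff)
  have other: "expsum j (\<tau> [x]) = lsign j x" if "x \<in> letters k" "j \<noteq> i" for j x
    using opts[OF that(1)] that(2) by (auto simp: i_def lsign_def)
  obtain w where w: "w \<in> carrier (free_group k)" "\<tau> w = [b]"
    using aut_bij[OF \<tau>] i(3) by (metis bij_betw_iff_bijections)
  have 0: "expsum j w = 0" if j: "j < k" "j \<noteq> i" for j
  proof -
    have "expsum j (\<tau> w) = (\<Sum>i'<k. expsum i' w * expsum j (\<tau> [(i', True)]))"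
      by (rule expsum_aut[OF \<tau> w(1)])
    also have "\<dots> = (\<Sum>i'<k. if i' = j then expsum j w else 0)"
      by (rule sum.cong) (use j other in \<open>auto simp: letters_def lsign_def\<close>)
    finally show ?thesis using j w(2) by (simp add: lsign_def i_def)
  qed
  have "expsum i (\<tau> w) = (\<Sum>i'<k. expsum i' w * expsum i (\<tau> [(i', True)]))"
    by (rule expsum_aut[OF \<tau> w(1)])
  also have "\<dots> = (\<Sum>i'<k. if i' = i then expsum i w * expsum i (\<tau> [(i, True)]) else 0)"
    by (rule sum.cong) (use 0 in auto)
  finally have "expsum i w * expsum i (\<tau> [(i, True)]) = lsign i b" using i w(2) by simp
  then have "\<bar>expsum i w * expsum i (\<tau> [(i, True)])\<bar> = 1" by (simp add: lsign_def i_def)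
  then have *: "\<bar>expsum i (\<tau> [(i, True)])\<bar> = 1" by (metis abs_mult abs_zmult_eq_1 mult.commute)
  have "b = (i, True) \<or> linv b = (i, True)" by (cases b) (auto simp: i_def linv_def)
  then have "\<bar>expsum i (\<tau> [b])\<bar> = 1"
  proof
    assume "linv b = (i, True)"
    moreover have "\<tau> [linv b] = winv (\<tau> [b])" using aut_winv[OF \<tau> i(3)] by simp
    ultimately show ?thesis using * by simp
  qed (use * in simp)
  then show ?thesis using opts[OF b] by (auto simp: reduce_def lsign_def i_def linv_def split: if_splits)
qed

text \<open>The cut consists of the letters whose image starts with \<open>b\<close>. Passing to inverses, it also tells which
  images end in \<open>linv b\<close>.\<close>

lemma whitehead2_wh:
  assumes "whitehead2 k \<tau>"
  obtains b B where "b \<in> letters k" "B \<subseteq> letters k" "b \<in> B" "linv b \<notin> B"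
    "\<And>w. w \<in> carrier (free_group k) \<Longrightarrow> \<tau> w = subst (wh b B) w"
proof -
  have \<tau>: "\<tau> \<in> auto (free_group k)" using assms by (simp add: whitehead2_def)
  obtain b where b: "b \<in> letters k" and opts: "\<And>x. x \<in> letters k \<Longrightarrow>
      \<tau> [x] \<in> {[x], reduce [x, linv b], reduce [b, x], reduce [b, x, linv b]}"
    using whitehead2_gen[OF assms] by blast
  define B where "B = {y \<in> letters k. hd (\<tau> [y]) = b}"
  have fixb: "\<tau> [b] = [b]" by (rule whitehead2_fixes_multiplier[OF \<tau> b opts])
  have inv: "\<tau> [linv x] = winv (\<tau> [x])" if "x \<in> letters k" for x
    using aut_winv[OF \<tau>, of "[x]"] that by simp
  have gen: "\<tau> [x] = reduce (wh b B x)" if x: "x \<in> letters k" for x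
  proof (cases "fst x = fst b")
    case True
    then show ?thesis using fixb inv[OF b] by (auto simp: wh_def fst_eq_iff)
  next
    case False
    then have ne: "x \<noteq> b" "x \<noteq> linv b" "b \<noteq> linv x" "b \<noteq> x" "linv b \<noteq> x" by auto
    then have o: "\<tau> [x] \<in> {[x], [x, linv b], [b, x], [b, x, linv b]}"
      using opts[OF x] by (auto simp: reduce_def)
    have "x \<in> B \<longleftrightarrow> hd (\<tau> [x]) = b" "linv x \<in> B \<longleftrightarrow> hd (winv (\<tau> [x])) = b"
      using x inv[OF x] by (simp_all add: B_def)
    then show ?thesis
      using ne False o by (elim insertE emptyE) (simp_all add: wh_def reduce_def)
  qed
  have "\<tau> w = subst (wh b B) w" if w: "w \<in> carrier (free_group k)" for w
  proof -
    have "subst (\<lambda>x. \<tau> [x]) w = subst (wh b B) w" if "set w \<subseteq> letters k" for w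
      using that by (induction w) (simp_all add: gen)
    then show ?thesis using w aut_subst_carrier[OF \<tau> w] by (simp add: in_carrier)
  qed
  moreover have "b \<in> B" "linv b \<notin> B" using b fixb inv[OF b] by (auto simp: B_def)
  ultimately show thesis using that[of b B] b by (auto simp: B_def)
qed

lemma subst_conj: "subst (\<lambda>x. reduce (g @ [x] @ winv g)) w = reduce (g @ w @ winv g)"
proof (induction w)
  case (Cons x w)
  have "subst (\<lambda>x. reduce (g @ [x] @ winv g)) (x # w) =
      reduce ((g @ [x]) @ winv g @ g @ w @ winv g)"
    using Cons by simp
  also have "\<dots> = reduce (g @ (x # w) @ winv g)" by (subst reduce_winv_cancel_simps(1)) simp
  finally show ?case .
qed simp

text \<open>The two excluded sizes of the cut belong to the identity and to the conjugation by \<open>b\<close>.\<close>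

lemma noninner_whitehead2:
  assumes wh2: "whitehead2 k \<tau>" and ni: "\<not> inner_aut k \<tau>"
  obtains b B where "b \<in> letters k" "B \<subseteq> letters k" "b \<in> B" "linv b \<notin> B"
    "2 \<le> card B" "card B + 2 \<le> 2 * k"
    "\<And>w. w \<in> carrier (free_group k) \<Longrightarrow> \<tau> w = subst (wh b B) w"
proof -
  obtain b B where b: "b \<in> letters k" "B \<subseteq> letters k" "b \<in> B" "linv b \<notin> B"
    and \<tau>: "\<And>w. w \<in> carrier (free_group k) \<Longrightarrow> \<tau> w = subst (wh b B) w"
    using whitehead2_wh[OF wh2] by blast
  have aut: "\<tau> \<in> auto (free_group k)" using wh2 by (simp add: whitehead2_def)
  have fin: "finite B" by (rule finite_subset[OF b(2)]) simp
  have "B \<noteq> {b}"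
  proof
    assume "B = {b}"
    then have "\<tau> w = w" if "w \<in> carrier (free_group k)" for w
      using \<tau>[OF that] that by (simp add: subst_wh_single in_carrier reduce_reduced)
    then have "inner_aut k \<tau>"
      using aut unfolding inner_aut_def
      by (auto intro!: bexI[of _ "[]"] simp: in_carrier reduce_reduced)
    then show False using ni by simp
  qed
  then have "card B \<noteq> 1" using b(3) by (auto simp: card_1_singleton_iff)
  moreover have "card B > 0" using b(3) fin by (auto simp: card_gt_0_iff)
  ultimately have 1: "2 \<le> card B" by simp
  have "B \<noteq> letters k - {linv b}"
  proof
    assume B: "B = letters k - {linv b}"
    have *: "reduce (wh b B x) = reduce ([b] @ [x] @ winv [b])" if "x \<in> letters k" for x
      using that b by (auto simp: wh_def B fst_eq_iff)
    then have "subst (wh b B) w = subst (\<lambda>x. reduce ([b] @ [x] @ winv [b])) w"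
      if "set w \<subseteq> letters k" for w
      using that
    proof (induction w)
      case (Cons x w)
      then have "reduce (reduce (wh b B x) @ subst (wh b B) w) =
          reduce (reduce ([b] @ [x] @ winv [b]) @ subst (\<lambda>x. reduce ([b] @ [x] @ winv [b])) w)"
        using *[of x] by simp
      then show ?case by simp
    qed simp
    then have "\<tau> w = reduce ([b] @ w @ winv [b])" if "w \<in> carrier (free_group k)" for w
      using \<tau>[OF that] that subst_conj[of "[b]" w] by (simp add: in_carrier)
    then have "inner_aut k \<tau>"
      using aut b(1) unfolding inner_aut_def
      by (auto intro!: bexI[of _ "[b]"])
    then show False using ni by simp
  qed
  then have "B \<subset> letters k - {linv b}" using b by blast
  then have "card B < card (letters k - {linv b})" by (intro psubset_card_mono) auto
  then have "card B + 2 \<le> 2 * k" using b(1) by simp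
  then show thesis using that[OF b 1 _ \<tau>] by blast
qed

section \<open>Cuts of the Cayley tree and their crossings\<close>

text \<open>A translate of the path \<open>U\<close> starts at \<open>g\<close> and ends at the product of \<open>g\<close> and \<open>U\<close>; it is counted when
  its ends lie on different sides of \<open>D\<close>, no matter how often the path changes sides in between.\<close>

definition crossings :: "nat \<Rightarrow> (letter list \<Rightarrow> bool) \<Rightarrow> letter list \<Rightarrow> letter list set" where
  "crossings k D U = {g \<in> carrier (free_group k). D g \<noteq> D (reduce (g @ U))}"

definition word_sphere :: "nat \<Rightarrow> nat \<Rightarrow> letter list set" where
  "word_sphere k r = {p \<in> carrier (free_group k). length p = r}"

definition word_ball :: "nat \<Rightarrow> nat \<Rightarrow> letter list set" where
  "word_ball k r = {p \<in> carrier (free_group k). length p \<le> r}"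

lemma finite_word_ball [simp]: "finite (word_ball k r)"
  by (rule finite_subset[OF _ finite_lists_length_le[of "letters k" r]])
     (auto simp: word_ball_def in_carrier)

lemma finite_word_sphere [simp]: "finite (word_sphere k r)"
  by (rule finite_subset[OF _ finite_word_ball[of k r]]) (auto simp: word_sphere_def word_ball_def)

lemma winv_take_Suc: "j < length U \<Longrightarrow> winv (take (Suc j) U) = linv (U ! j) # winv (take j U)"
  by (simp add: take_Suc_conv_app_nth)

lemma drop_winv_take: "i \<le> length U \<Longrightarrow> drop d (winv (take i U)) = winv (take (i - d) U)"
  by (simp add: winv_def drop_rev drop_map[symmetric] take_map[symmetric] min_def)

lemma reduced_take: "reduced w \<Longrightarrow> reduced (take n w)"
  and reduced_drop: "reduced w \<Longrightarrow> reduced (drop n w)"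
  using reduced_append[of "take n w" "drop n w"] by simp_all

lemma turn_split:
  assumes "reduced U" "reduced p" "Suc j < length U"
    and "p \<noteq> [] \<Longrightarrow> linv (U ! j) \<noteq> linv (last p) \<and> U ! Suc j \<noteq> linv (last p)"
  shows "reduce (p @ winv (take (Suc j) U)) = p @ winv (take (Suc j) U)"
    and "reduce (p @ winv (take (Suc j) U) @ U) = p @ drop (Suc j) U"
proof -
  have "reduced (p @ winv (take (Suc j) U))"
    using assms reduced_winv[OF reduced_take[OF assms(1), of "Suc j"]]
    by (auto simp: reduced_append winv_take_Suc)
  then show "reduce (p @ winv (take (Suc j) U)) = p @ winv (take (Suc j) U)"
    by (rule reduce_reduced)
  have "reduce (p @ winv (take (Suc j) U) @ U) =
      reduce (p @ winv (take (Suc j) U) @ take (Suc j) U @ drop (Suc j) U)" by simp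
  also have "\<dots> = reduce (p @ drop (Suc j) U)" by (simp only: reduce_winv_cancel_simps)
  also have "reduced (p @ drop (Suc j) U)"
    using assms reduced_drop[OF assms(1), of "Suc j"]
    by (auto simp: reduced_append hd_drop_conv_nth)
  then have "reduce (p @ drop (Suc j) U) = p @ drop (Suc j) U" by (rule reduce_reduced)
  finally show "reduce (p @ winv (take (Suc j) U) @ U) = p @ drop (Suc j) U" .
qed

text \<open>The starting vertex of that translate of the path \<open>U\<close> which has reached \<open>p\<close> after \<open>Suc j\<close> letters.\<close>

definition turn_point :: "letter list \<Rightarrow> letter list \<times> nat \<Rightarrow> letter list" where
  "turn_point U = (\<lambda>(p, j). reduce (p @ winv (take (Suc j) U)))"

text \<open>The condition on \<open>x\<close> leaves out the edge from \<open>p\<close> back to the root.\<close>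

definition flips :: "(letter list \<Rightarrow> bool) \<Rightarrow> letter list \<Rightarrow> letter set" where
  "flips \<kappa> p = {x. (p \<noteq> [] \<longrightarrow> x \<noteq> linv (last p)) \<and> \<kappa> (p @ [x]) \<noteq> \<kappa> p}"

text \<open>Put at \<open>p\<close>, these turns of \<open>U\<close> connect a flipped to an unflipped direction, both leading away from
  the root.\<close>

definition inner_turns :: "(letter list \<Rightarrow> bool) \<Rightarrow> letter list \<Rightarrow> letter list \<Rightarrow> nat set" where
  "inner_turns \<kappa> U p = {j. Suc j < length U \<and>
     (p \<noteq> [] \<longrightarrow> linv (U ! j) \<noteq> linv (last p) \<and> U ! Suc j \<noteq> linv (last p)) \<and>
     (linv (U ! j) \<in> flips \<kappa> p) \<noteq> (U ! Suc j \<in> flips \<kappa> p)}"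

text \<open>Put at \<open>p\<close>, these turns of \<open>U\<close> connect a flipped direction to the edge back to the root.\<close>

definition outer_turns :: "(letter list \<Rightarrow> bool) \<Rightarrow> letter list \<Rightarrow> letter list \<Rightarrow> nat set" where
  "outer_turns \<kappa> U p = {j. Suc j < length U \<and>
     (linv (U ! j) = linv (last p) \<and> U ! Suc j \<in> flips \<kappa> p \<or>
      U ! Suc j = linv (last p) \<and> linv (U ! j) \<in> flips \<kappa> p)}"

lemma finite_turns [simp]: "finite (inner_turns \<kappa> U p)" "finite (outer_turns \<kappa> U p)"
  by (rule finite_subset[of _ "{..<length U}"], auto simp: inner_turns_def outer_turns_def)+

context
  fixes k U assumes U: "U \<in> carrier (free_group k)"
begin

lemma U_reduced: "reduced U" and U_set: "set U \<subseteq> letters k"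
  using U by (simp_all add: in_carrier)

lemma turn_point_closed: "p \<in> carrier (free_group k) \<Longrightarrow> turn_point U (p, j) \<in> carrier (free_group k)"
proof -
  assume "p \<in> carrier (free_group k)"
  moreover have "set (take (Suc j) U) \<subseteq> letters k"
    using U_set set_take_subset by (rule order_trans[rotated])
  ultimately have "set (p @ winv (take (Suc j) U)) \<subseteq> letters k" by (simp add: in_carrier)
  then show ?thesis unfolding turn_point_def prod.case by (rule reduce_in_carrier)
qed

lemma inner_turns_point:
  assumes "p \<in> word_sphere k r" "j \<in> inner_turns \<kappa> U p"
  shows "turn_point U (p, j) = p @ linv (U ! j) # winv (take j U)"
    and "reduce (turn_point U (p, j) @ U) = p @ U ! Suc j # drop (Suc (Suc j)) U"
proof -
  have j: "Suc j < length U" and p: "reduced p"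
    and t: "p \<noteq> [] \<Longrightarrow> linv (U ! j) \<noteq> linv (last p) \<and> U ! Suc j \<noteq> linv (last p)"
    using assms by (auto simp: inner_turns_def word_sphere_def in_carrier)
  show 1: "turn_point U (p, j) = p @ linv (U ! j) # winv (take j U)"
    using turn_split(1)[OF U_reduced p j t] j by (simp add: turn_point_def winv_take_Suc)
  show "reduce (turn_point U (p, j) @ U) = p @ U ! Suc j # drop (Suc (Suc j)) U"
    using turn_split(2)[OF U_reduced p j t] j
    by (simp add: turn_point_def Cons_nth_drop_Suc)
qed

text \<open>No cancellation occurs at such a turn, so both ends of the path have \<open>p\<close> as a prefix; the colours of
  level \<open>r\<close> agree while those of level \<open>Suc r\<close> differ.\<close>

lemma inner_turns_crossing:
  assumes "p \<in> word_sphere k r" "j \<in> inner_turns \<kappa> U p"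
  shows "turn_point U (p, j) \<in> crossings k (\<lambda>g. \<kappa> (take (Suc r) g)) U - crossings k (\<lambda>g. \<kappa> (take r g)) U"
proof -
  define g where "g = turn_point U (p, j)"
  have p: "length p = r" "p \<in> carrier (free_group k)" using assms by (auto simp: word_sphere_def)
  have "take r g = p" "take (Suc r) g = p @ [linv (U ! j)]"
    and "take r (reduce (g @ U)) = p" "take (Suc r) (reduce (g @ U)) = p @ [U ! Suc j]"
    using inner_turns_point[OF assms] p(1) by (simp_all add: g_def[symmetric])
  moreover have "(\<kappa> (p @ [linv (U ! j)]) \<noteq> \<kappa> p) \<noteq> (\<kappa> (p @ [U ! Suc j]) \<noteq> \<kappa> p)"
    using assms(2) by (auto simp: inner_turns_def flips_def)
  moreover have "g \<in> carrier (free_group k)"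
    unfolding g_def by (rule turn_point_closed[OF p(2)])
  ultimately show ?thesis
    unfolding g_def[symmetric] by (auto simp: crossings_def)
qed

lemma inj_on_turn_point: "inj_on (turn_point U) (Sigma (word_sphere k r) (inner_turns \<kappa> U))"
proof (rule inj_onI, clarify)
  fix p j p' j'
  assume p: "p \<in> word_sphere k r" "j \<in> inner_turns \<kappa> U p" and p': "p' \<in> word_sphere k r" "j' \<in> inner_turns \<kappa> U p'"
    and eq: "turn_point U (p, j) = turn_point U (p', j')"
  then have "p @ linv (U ! j) # winv (take j U) = p' @ linv (U ! j') # winv (take j' U)"
    by (simp add: inner_turns_point[OF p] inner_turns_point[OF p'])
  moreover have "length p = length p'" using p p' by (simp add: word_sphere_def)
  ultimately have "p = p'" "length (winv (take j U)) = length (winv (take j' U))" by simp_all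
  then show "p = p' \<and> j = j'" using p p' by (simp add: inner_turns_def)
qed

lemma crossings_common_prefix:
  assumes "g \<in> crossings k (\<lambda>g. \<kappa> (take r g)) U"
  obtains i s where "i \<le> length U" "g = s @ winv (take i U)" "reduce (g @ U) = s @ drop i U" "length s < r"
proof -
  have "reduced g" using assms by (simp add: crossings_def in_carrier)
  then obtain i s where gs: "i \<le> length U" "g = s @ winv (take i U)" "reduce (g @ U) = s @ drop i U"
    using cancellation[OF _ U_reduced] by blast
  have "length s < r"
  proof (rule ccontr)
    assume "\<not> length s < r"
    then have "take r g = take r s" "take r (reduce (g @ U)) = take r s"
      by (simp add: gs(2), simp add: gs(3))
    then show False using assms by (simp add: crossings_def)
  qed
  then show thesis using that gs by blast
qed

lemma finite_crossings_take: "finite (crossings k (\<lambda>g. \<kappa> (take r g)) U)"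
proof (rule finite_subset)
  show "crossings k (\<lambda>g. \<kappa> (take r g)) U \<subseteq> word_ball k (r + length U)"
  proof
    fix g assume g: "g \<in> crossings k (\<lambda>g. \<kappa> (take r g)) U"
    then obtain i s where "g = s @ winv (take i U)" "length s < r"
      using crossings_common_prefix by blast
    then show "g \<in> word_ball k (r + length U)" using g by (simp add: word_ball_def crossings_def)
  qed
qed simp

text \<open>If the ends differ in colour at level \<open>r\<close> but not at level \<open>Suc r\<close>, one of them lies beyond a flip at a
  vertex \<open>p\<close> of level \<open>r\<close>. The other end does not have \<open>p\<close> as a prefix, so the path has to run through
  \<open>p\<close> towards the root.\<close>

lemma outer_crossing:
  assumes r: "r > 0"
    and g: "g \<in> crossings k (\<lambda>g. \<kappa> (take r g)) U - crossings k (\<lambda>g. \<kappa> (take (Suc r) g)) U"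
  shows "g \<in> turn_point U ` Sigma (word_sphere k r) (outer_turns \<kappa> U)"
proof -
  define g' where "g' = reduce (g @ U)"
  have gF: "g \<in> carrier (free_group k)" "g' \<in> carrier (free_group k)"
    using g U by (auto simp: crossings_def g'_def mult_closed)
  have ne: "\<kappa> (take r g) \<noteq> \<kappa> (take r g')" and eq: "\<kappa> (take (Suc r) g) = \<kappa> (take (Suc r) g')"
    using g by (auto simp: crossings_def g'_def)
  obtain i s where i: "i \<le> length U" and s: "length s < r"
    and gs: "g = s @ winv (take i U)" and gs': "g' = s @ drop i U"
    using crossings_common_prefix[of g \<kappa> r] g unfolding g'_def by blast
  have split: "h = take r h @ h ! r # drop (Suc r) h" "take (Suc r) h = take r h @ [h ! r]"
    "take r h \<in> word_sphere k r" "h ! r \<noteq> linv (last (take r h))" "last (take r h) = h ! (r - 1)"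
    if "r < length h" "h \<in> carrier (free_group k)" for h
  proof -
    show 1: "h = take r h @ h ! r # drop (Suc r) h" "take (Suc r) h = take r h @ [h ! r]"
      using that by (simp_all add: id_take_nth_drop[symmetric] take_Suc_conv_app_nth)
    show "take r h \<in> word_sphere k r"
      using that by (auto simp: word_sphere_def in_carrier reduced_take dest: in_set_takeD)
    have "reduced (take r h @ h ! r # drop (Suc r) h)" using that 1 by (simp add: in_carrier)
    then show "h ! r \<noteq> linv (last (take r h))" using that r by (auto simp: reduced_append)
    show "last (take r h) = h ! (r - 1)" using that r by (subst last_conv_nth) (auto simp: min_def)
  qed
  have "\<kappa> (take (Suc r) g) \<noteq> \<kappa> (take r g) \<or> \<kappa> (take (Suc r) g') \<noteq> \<kappa> (take r g')"
    using ne eq by auto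
  then show ?thesis
  proof
    assume flip: "\<kappa> (take (Suc r) g) \<noteq> \<kappa> (take r g)"
    then have len: "r < length g" by (metis not_less take_all le_SucI)
    note sp = split[OF len gF(1)]
    define m where "m = i - (r - length s)"
    have leng: "length g = length s + i" using gs i by simp
    have m: "0 < m" "m < i" using len leng s by (auto simp: m_def)
    have dr: "drop r g = winv (take m U)"
      using gs s i drop_winv_take[OF i, of "r - length s"] by (simp add: m_def)
    have dr1: "drop (r - 1) g = winv (take (Suc m) U)"
    proof -
      have "i - (r - 1 - length s) = Suc m" using s len leng r by (simp add: m_def)
      then show ?thesis using gs s i drop_winv_take[OF i, of "r - 1 - length s"] by simp
    qed
    have "g ! r = linv (U ! (m - 1))"
      using hd_drop_conv_nth[of r g] len m i winv_take_Suc[of "m - 1" U] by (simp add: dr)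
    moreover have "g ! (r - 1) = linv (U ! m)"
      using hd_drop_conv_nth[of "r - 1" g] len m i winv_take_Suc[of m U] by (simp add: dr1 del: One_nat_def)
    ultimately have "m - 1 \<in> outer_turns \<kappa> U (take r g)"
      using m i sp flip by (auto simp: outer_turns_def flips_def)
    moreover have "turn_point U (take r g, m - 1) = g"
    proof -
      have "take r g @ winv (take m U) = g" by (simp flip: dr)
      then show ?thesis using m gF by (simp add: turn_point_def reduce_reduced in_carrier)
    qed
    ultimately show ?thesis using sp(3) by (metis (no_types, lifting) SigmaI image_eqI)
  next
    assume flip: "\<kappa> (take (Suc r) g') \<noteq> \<kappa> (take r g')"
    then have len: "r < length g'" by (metis not_less take_all le_SucI)
    note sp = split[OF len gF(2)]
    define m where "m = i + (r - length s)"
    have m: "0 < m" "i < m" using s by (auto simp: m_def)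
    have dr: "drop r g' = drop m U"
      using gs' s by (simp add: m_def add.commute)
    have mU: "m < length U" using dr len by (metis drop_eq_Nil not_less)
    have dr1: "drop (r - 1) g' = drop (m - 1) U"
    proof -
      have "r - 1 - length s + i = m - 1" using s by (simp add: m_def)
      then show ?thesis using gs' s by simp
    qed
    have "g' ! r = U ! m"
      using hd_drop_conv_nth[of r g'] hd_drop_conv_nth[of m U] len mU by (simp add: dr)
    moreover have "g' ! (r - 1) = U ! (m - 1)"
      using hd_drop_conv_nth[of "r - 1" g'] hd_drop_conv_nth[of "m - 1" U] len mU by (simp add: dr1 del: One_nat_def)
    ultimately have "m - 1 \<in> outer_turns \<kappa> U (take r g')"
      using m mU sp flip by (auto simp: outer_turns_def flips_def)
    moreover have "turn_point U (take r g', m - 1) = g"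
    proof -
      have "g = reduce (g' @ winv U)"
        using gF(1) by (simp add: g'_def in_carrier reduce_reduced)
      also have "g' = take r g' @ drop m U" by (simp flip: dr)
      also have "winv U = winv (drop m U) @ winv (take m U)"
        by (metis append_take_drop_id winv_simps(3))
      also have "reduce ((take r g' @ drop m U) @ winv (drop m U) @ winv (take m U)) =
          reduce (take r g' @ winv (take m U))" by simp
      finally show ?thesis using m by (simp add: turn_point_def)
    qed
    ultimately show ?thesis using sp(3) by (metis (no_types, lifting) SigmaI image_eqI)
  qed
qed

text \<open>Cutting the colouring off one level earlier loses all inner turns, which are crossings of the finer
  cut only, and gains at most the outer ones.\<close>

lemma card_crossings_step:
  assumes "r > 0"
  shows "card (crossings k (\<lambda>g. \<kappa> (take r g)) U) + (\<Sum>p\<in>word_sphere k r. card (inner_turns \<kappa> U p))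
    \<le> card (crossings k (\<lambda>g. \<kappa> (take (Suc r) g)) U) + (\<Sum>p\<in>word_sphere k r. card (outer_turns \<kappa> U p))"
proof -
  let ?A = "crossings k (\<lambda>g. \<kappa> (take r g)) U" and ?B = "crossings k (\<lambda>g. \<kappa> (take (Suc r) g)) U"
  have fin: "finite ?A" "finite ?B" by (rule finite_crossings_take)+
  have "(\<Sum>p\<in>word_sphere k r. card (inner_turns \<kappa> U p)) = card (turn_point U ` Sigma (word_sphere k r) (inner_turns \<kappa> U))"
    by (subst card_image[OF inj_on_turn_point]) simp
  also have "\<dots> \<le> card (?B - ?A)"
    using fin inner_turns_crossing by (intro card_mono) auto
  finally have 1: "(\<Sum>p\<in>word_sphere k r. card (inner_turns \<kappa> U p)) \<le> card (?B - ?A)" .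
  have "card (?A - ?B) \<le> card (turn_point U ` Sigma (word_sphere k r) (outer_turns \<kappa> U))"
    using outer_crossing[OF assms] by (intro card_mono) auto
  also have "\<dots> \<le> card (Sigma (word_sphere k r) (outer_turns \<kappa> U))" by (rule card_image_le) auto
  also have "\<dots> = (\<Sum>p\<in>word_sphere k r. card (outer_turns \<kappa> U p))" by simp
  finally have 2: "card (?A - ?B) \<le> (\<Sum>p\<in>word_sphere k r. card (outer_turns \<kappa> U p))" .
  have "card ?A = card (?A \<inter> ?B) + card (?A - ?B)" "card ?B = card (?A \<inter> ?B) + card (?B - ?A)"
    using card_Int_Diff[OF fin(1), of ?B] card_Int_Diff[OF fin(2), of ?A] by (simp_all add: Int_commute)
  then show ?thesis using 1 2 by simp
qed

lemma card_crossings_first: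
  "pairsum (straddle (flips \<kappa> [])) U \<le> int (card (crossings k (\<lambda>g. \<kappa> (take (Suc 0) g)) U))"
proof -
  have S: "word_sphere k 0 = {[]}" by (auto simp: word_sphere_def)
  have "pairsum (straddle (flips \<kappa> [])) U = int (card {i. i < length U - 1 \<and>
      (linv (U ! i) \<in> flips \<kappa> []) \<noteq> (U ! Suc i \<in> flips \<kappa> [])})"
    unfolding pairsum_def straddle_def by (simp add: Int_def)
  also have "{i. i < length U - 1 \<and> (linv (U ! i) \<in> flips \<kappa> []) \<noteq> (U ! Suc i \<in> flips \<kappa> [])} =
      inner_turns \<kappa> U []" by (auto simp: inner_turns_def)
  also have "card (inner_turns \<kappa> U []) = card (turn_point U ` Sigma (word_sphere k 0) (inner_turns \<kappa> U))"
    by (subst card_image[OF inj_on_turn_point]) (simp add: S)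
  also have "\<dots> \<le> card (crossings k (\<lambda>g. \<kappa> (take (Suc 0) g)) U)"
    using finite_crossings_take inner_turns_crossing[of _ 0] by (intro card_mono) auto
  finally show ?thesis by simp
qed

text \<open>This is where the stars of the tree meet the Whitehead graph: what pruning gains at \<open>p\<close> is the
  difference between two cuts that separate the direction back to the root from the straight
  continuation.\<close>

lemma turns_pairsum:
  assumes "p \<noteq> []"
  shows "int (card (outer_turns \<kappa> U p)) - int (card (inner_turns \<kappa> U p)) =
    pairsum (straddle {linv (last p)}) U - pairsum (straddle (insert (linv (last p)) (flips \<kappa> p))) U"
proof -
  let ?b = "linv (last p)" and ?N = "flips \<kappa> p"
  have b: "?b \<notin> ?N" using assms by (simp add: flips_def)
  have card: "int (card {i. Suc i < length U \<and> P i}) = (\<Sum>i<length U - 1. of_bool (P i))" for P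
  proof -
    have "{i. Suc i < length U \<and> P i} = {..<length U - 1} \<inter> {i. P i}" by auto
    then show ?thesis by simp
  qed
  have red: "U ! Suc i \<noteq> linv (U ! i)" if "Suc i < length U" for i
    using U_reduced that by (simp add: reduced_def successively_conv_nth)
  show ?thesis
    unfolding outer_turns_def inner_turns_def card pairsum_def sum_subtractf[symmetric]
  proof (rule sum.cong)
    fix i assume "i \<in> {..<length U - 1}"
    then have "U ! Suc i \<noteq> linv (U ! i)" using red by simp
    then show "of_bool (linv (U ! i) = ?b \<and> U ! Suc i \<in> ?N \<or> U ! Suc i = ?b \<and> linv (U ! i) \<in> ?N) -
      of_bool ((p \<noteq> [] \<longrightarrow> linv (U ! i) \<noteq> ?b \<and> U ! Suc i \<noteq> ?b) \<and>
        (linv (U ! i) \<in> ?N) \<noteq> (U ! Suc i \<in> ?N)) =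
      straddle {?b} (U ! i) (U ! Suc i) - straddle (insert ?b ?N) (U ! i) (U ! Suc i)"
      using b assms by (cases "linv (U ! i) = ?b"; cases "U ! Suc i = ?b") (auto simp: straddle_def)
  qed simp
qed

end

section \<open>Powers of a cut-minimal word cross every cut often\<close>

lemma pairsum_wpow:
  fixes f :: "letter \<Rightarrow> letter \<Rightarrow> int"
  assumes "u \<noteq> []"
  shows "pairsum f (wpow u n @ [hd u]) = int n * pairsum f (u @ [hd u])"
proof (induction n)
  case (Suc n)
  have "hd (wpow u n @ [hd u]) = hd u" using assms by (cases n) auto
  then have "pairsum f (u @ wpow u n @ [hd u]) =
      pairsum f u + f (last u) (hd u) + pairsum f (wpow u n @ [hd u])"
    using assms pairsum_append[of u "wpow u n @ [hd u]" f] by simp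
  moreover have "pairsum f (u @ [hd u]) = pairsum f u + f (last u) (hd u)"
    using assms pairsum_append[of u "[hd u]" f] by simp
  ultimately show ?case using Suc by (simp add: algebra_simps)
qed simp

text \<open>The word \<open>wpow u n\<close> has all the turns of \<open>n\<close> copies of the cyclic word \<open>u\<close> except the one that closes
  it up.\<close>

lemma pairsum_straddle_wpow:
  assumes "u \<noteq> []" "n > 0"
  shows "pairsum (straddle B) (wpow u n) \<le> int n * pairsum (straddle B) (u @ [hd u])"
    and "int n * pairsum (straddle B) (u @ [hd u]) \<le> pairsum (straddle B) (wpow u n) + 1"
proof -
  have "pairsum (straddle B) (wpow u n @ [hd u]) =
      pairsum (straddle B) (wpow u n) + straddle B (last (wpow u n)) (hd u)"
    using assms pairsum_append[of "wpow u n" "[hd u]" "straddle B"] by simp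
  moreover have "0 \<le> straddle B x y" "straddle B x y \<le> 1" for x y by (auto simp: straddle_def)
  ultimately show "pairsum (straddle B) (wpow u n) \<le> int n * pairsum (straddle B) (u @ [hd u])"
    "int n * pairsum (straddle B) (u @ [hd u]) \<le> pairsum (straddle B) (wpow u n) + 1"
    using pairsum_wpow[OF assms(1), of "straddle B" n] by simp_all
qed

definition gen_count :: "nat \<Rightarrow> letter list \<Rightarrow> nat" where
  "gen_count j w = length (filter (\<lambda>x. fst x = j) w)"

lemma pairsum_fst:
  "pairsum (\<lambda>x y. of_bool (fst x \<noteq> j)) (u @ [y]) = int (length u) - int (gen_count j u)"
  by (induction u) (auto simp: pairsum_Cons gen_count_def)

lemma gen_count_straddle:
  assumes "cyc_reduced u" "u \<noteq> []"
  shows "pairsum (straddle {b}) (u @ [hd u]) = int (gen_count (fst b) u)"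
  using pairsum_straddle_single[OF assms, of b] by (simp add: pairsum_add pairsum_fst)

lemma sum_gen_count:
  assumes "set w \<subseteq> letters k"
  shows "(\<Sum>j<k. gen_count j w) = length w"
  using assms
proof (induction w)
  case (Cons x w)
  have "(\<Sum>j<k. gen_count j (x # w)) = (\<Sum>j<k. (if j = fst x then 1 else 0) + gen_count j w)"
    by (rule sum.cong) (auto simp: gen_count_def)
  also have "\<dots> = 1 + length w"
    using Cons by (simp add: sum.distrib letters_def mem_Times_iff)
  finally show ?case by simp
qed (simp add: gen_count_def)

definition cut_boundary :: "nat \<Rightarrow> (letter list \<Rightarrow> bool) \<Rightarrow> letter list set" where
  "cut_boundary k D = {g \<in> carrier (free_group k). \<exists>x\<in>letters k. D g \<noteq> D (reduce (g @ [x]))}"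

lemma constant_beyond_boundary:
  assumes "\<And>g. g \<in> cut_boundary k D \<Longrightarrow> length g < R"
    and "g @ t \<in> carrier (free_group k)" "R \<le> length g"
  shows "D (g @ t) = D g"
  using assms(2)
proof (induction t rule: rev_induct)
  case (snoc x t)
  then have c: "g @ t \<in> carrier (free_group k)" "x \<in> letters k" "reduced (g @ t @ [x])"
    using reduced_append[of "g @ t" "[x]"] by (auto simp: in_carrier)
  then have "g @ t \<notin> cut_boundary k D" using assms(1)[of "g @ t"] assms(3) by auto
  then have "D (g @ t @ [x]) = D (g @ t)"
    using c by (auto simp: cut_boundary_def reduce_reduced)
  then show ?case using snoc.IH c(1) by simp
qed simp

lemma replicate_last_closed:
  assumes "p \<in> carrier (free_group k)" "p \<noteq> []"
  shows "p @ replicate m (last p) \<in> carrier (free_group k)"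
proof (induction m)
  case (Suc m)
  have "p @ replicate (Suc m) (last p) = (p @ replicate m (last p)) @ [last p]"
    by (simp add: replicate_append_same)
  moreover have "last (p @ replicate m (last p)) = last p" by (cases m) (auto simp: last_replicate)
  moreover from this have "reduced ((p @ replicate m (last p)) @ [last p])"
    using Suc by (subst reduced_append) (simp add: in_carrier reduced_Cons)
  ultimately show ?case
    using Suc assms last_in_set[OF assms(2)] by (auto simp: in_carrier)
qed (use assms in simp)

lemma bij_betw_Collect_carrier:
  assumes "bij_betw f A A" "\<And>g. g \<in> A \<Longrightarrow> P g \<longleftrightarrow> Q (f g)"
  shows "bij_betw f {g \<in> A. P g} {g \<in> A. Q g}"
  using assms unfolding bij_betw_def inj_on_def
  by (auto, metis (no_types, lifting) image_iff mem_Collect_eq)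

lemma bij_left_mult:
  assumes "h \<in> carrier (free_group k)"
  shows "bij_betw (\<lambda>g. reduce (h @ g)) (carrier (free_group k)) (carrier (free_group k))"
  by (rule bij_betw_byWitness[where f' = "\<lambda>g. reduce (winv h @ g)"])
     (use assms in \<open>auto simp: mult_closed, auto simp: in_carrier reduce_reduced\<close>)

context
  fixes k u
  assumes min: "cut_minimal k u" and u: "cyc_reduced u" "u \<noteq> []" "set u \<subseteq> letters k"
begin

lemma wpow_in_carrier: "wpow u n \<in> carrier (free_group k)"
  using reduced_wpow[OF u(1), of n] set_wpow[of n u] u(3) by (auto simp: in_carrier)

text \<open>The colour does not change along the straight continuation of \<open>p\<close>, so the inverse of the direction
  back to the root stays outside the cut and minimality applies at every vertex. The error of one per
  vertex comes from the turn that is missing in the power, and does not depend on \<open>n\<close>.\<close>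

lemma card_crossings_prune:
  assumes straight: "\<And>p. p \<in> carrier (free_group k) \<Longrightarrow> p \<noteq> [] \<Longrightarrow> \<kappa> (p @ [last p]) = \<kappa> p"
    and r: "r > 0" and n: "n > 0"
  shows "card (crossings k (\<lambda>g. \<kappa> (take r g)) (wpow u n))
    \<le> card (crossings k (\<lambda>g. \<kappa> (take (Suc r) g)) (wpow u n)) + card (word_sphere k r)"
proof -
  let ?U = "wpow u n"
  have "int (card (outer_turns \<kappa> ?U p)) - int (card (inner_turns \<kappa> ?U p)) \<le> 1"
    if p: "p \<in> word_sphere k r" for p
  proof -
    have ne: "p \<noteq> []" and pF: "p \<in> carrier (free_group k)" using p r by (auto simp: word_sphere_def)
    define b where "b = linv (last p)"
    have "last p \<in> letters k" using pF ne last_in_set[OF ne] by (auto simp: in_carrier)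
    then have "b \<in> letters k" "linv b \<notin> insert b (flips \<kappa> p)"
      using straight[OF pF ne] by (auto simp: b_def flips_def)
    then have "pairsum (straddle {b}) (u @ [hd u]) \<le> pairsum (straddle (insert b (flips \<kappa> p))) (u @ [hd u])"
      using min unfolding cut_minimal_def by blast
    then have "int n * pairsum (straddle {b}) (u @ [hd u]) \<le>
        int n * pairsum (straddle (insert b (flips \<kappa> p))) (u @ [hd u])" by (rule mult_left_mono) simp
    then show ?thesis
      using turns_pairsum[OF wpow_in_carrier ne, of \<kappa> n] pairsum_straddle_wpow[OF u(2) n]
      unfolding b_def[symmetric] by (smt (verit, best))
  qed
  then have "(\<Sum>p\<in>word_sphere k r. int (card (outer_turns \<kappa> ?U p)) - int (card (inner_turns \<kappa> ?U p)))
      \<le> (\<Sum>p\<in>word_sphere k r. 1)" by (rule sum_mono)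
  then have "int (\<Sum>p\<in>word_sphere k r. card (outer_turns \<kappa> ?U p)) \<le>
      int (\<Sum>p\<in>word_sphere k r. card (inner_turns \<kappa> ?U p)) + int (card (word_sphere k r))"
    by (simp add: sum_subtractf)
  then show ?thesis
    using card_crossings_step[OF wpow_in_carrier r, of \<kappa> n] by linarith
qed

text \<open>Pruning down to level one leaves a cut of the star of the root. It separates \<open>x\<close> from \<open>linv x\<close>, and
  minimality compares it with the cut around \<open>x\<close> alone.\<close>

lemma gen_count_le_crossings_colouring:
  assumes straight: "\<And>p. p \<in> carrier (free_group k) \<Longrightarrow> p \<noteq> [] \<Longrightarrow> \<kappa> (p @ [last p]) = \<kappa> p"
    and n: "n > 0" and x: "x \<in> letters k" "\<kappa> [x] \<noteq> \<kappa> [linv x]"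
  shows "n * gen_count (fst x) u \<le>
    card (crossings k (\<lambda>g. \<kappa> (take (Suc r) g)) (wpow u n)) + (\<Sum>i\<le>r. card (word_sphere k i)) + 1"
proof -
  have "\<exists>y. y \<in> letters k \<and> fst y = fst x \<and> y \<in> flips \<kappa> [] \<and> linv y \<notin> flips \<kappa> []"
  proof (cases "x \<in> flips \<kappa> []")
    case True
    then show ?thesis using x by (intro exI[of _ x]) (auto simp: flips_def)
  next
    case False
    then show ?thesis using x by (intro exI[of _ "linv x"]) (auto simp: flips_def)
  qed
  then obtain y where y: "y \<in> letters k" "fst y = fst x" "y \<in> flips \<kappa> []" "linv y \<notin> flips \<kappa> []"
    by blast
  then have "int (gen_count (fst x) u) \<le> pairsum (straddle (flips \<kappa> [])) (u @ [hd u])"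
    using min gen_count_straddle[OF u(1,2), of y] unfolding cut_minimal_def by metis
  then have "int n * int (gen_count (fst x) u) \<le> int n * pairsum (straddle (flips \<kappa> [])) (u @ [hd u])"
    by (rule mult_left_mono) simp
  then have "int (n * gen_count (fst x) u) \<le> int (card (crossings k (\<lambda>g. \<kappa> (take (Suc 0) g)) (wpow u n))) + 1"
    using pairsum_straddle_wpow(2)[OF u(2) n, of "flips \<kappa> []"]
      card_crossings_first[OF wpow_in_carrier, of \<kappa> n] by simp
  then have 0: "n * gen_count (fst x) u \<le> card (crossings k (\<lambda>g. \<kappa> (take (Suc 0) g)) (wpow u n)) + 1"
    by linarith
  show ?thesis
  proof (induction r)
    case (Suc r)
    then show ?case using card_crossings_prune[of \<kappa> "Suc r" n, OF straight _ n] by simp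
  qed (use 0 in simp)
qed

text \<open>Beyond its boundary the cut is determined by its values far out, so it agrees outside a ball with a
  colouring that is constant along straight continuations. The paths that start or end in the ball are
  bounded in number.\<close>

lemma gen_count_le_crossings_from_origin:
  assumes fin: "finite (cut_boundary k D)" and x: "x \<in> letters k"
    and sep: "\<And>M. \<exists>m\<ge>M. D (replicate m x) \<noteq> D (replicate m (linv x))"
  shows "\<exists>C. \<forall>n>0. n * gen_count (fst x) u \<le> card (crossings k D (wpow u n)) + C"
proof -
  obtain R where R: "\<And>g. g \<in> cut_boundary k D \<Longrightarrow> length g < Suc R"
  proof -
    have "finite (length ` cut_boundary k D)" using fin by simp
    then obtain R where "\<forall>l \<in> length ` cut_boundary k D. l \<le> R"
      using finite_nat_set_iff_bounded_le by blast
    then show thesis using that[of R] by (auto simp: less_Suc_eq_le)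
  qed
  have const: "D (g @ t) = D g" if "g @ t \<in> carrier (free_group k)" "Suc R \<le> length g" for g t
    using constant_beyond_boundary[of k D "Suc R" g t] R that by blast
  \<comment> \<open>The value of the cut far out on the ray that continues \<open>p\<close> straight on.\<close>
  define \<kappa> where "\<kappa> p = D (p @ replicate (Suc R) (last p))" for p
  have straight: "\<kappa> (p @ [last p]) = \<kappa> p" if p: "p \<in> carrier (free_group k)" "p \<noteq> []" for p
  proof -
    have "(p @ replicate (Suc R) (last p)) @ [last p] \<in> carrier (free_group k)"
      using replicate_last_closed[OF p, of "Suc (Suc R)"] by (simp add: replicate_append_same)
    then have "D ((p @ replicate (Suc R) (last p)) @ [last p]) = D (p @ replicate (Suc R) (last p))"
      by (rule const) simp
    then show ?thesis by (simp add: \<kappa>_def replicate_append_same)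
  qed
  have far: "\<kappa> (take (Suc R) g) = D g" if g: "g \<in> carrier (free_group k)" "Suc R \<le> length g" for g
  proof -
    define p where "p = take (Suc R) g"
    have p: "p \<in> carrier (free_group k)" "p \<noteq> []" "Suc R \<le> length p"
      using g by (auto simp: p_def in_carrier reduced_take dest: in_set_takeD)
    have "p @ drop (Suc R) g = g" by (simp add: p_def)
    then have "D g = D p" using const[of p "drop (Suc R) g"] g p by simp
    also have "\<dots> = \<kappa> p"
      unfolding \<kappa>_def by (rule const[OF replicate_last_closed[OF p(1,2)] p(3), symmetric])
    finally show ?thesis by (simp add: p_def)
  qed
  have flip: "\<kappa> [x] \<noteq> \<kappa> [linv x]"
  proof -
    obtain m where m: "m \<ge> Suc (Suc R)" "D (replicate m x) \<noteq> D (replicate m (linv x))"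
      using sep by blast
    have "D (replicate m y) = \<kappa> [y]" if y: "y \<in> letters k" for y
    proof -
      obtain m' where m': "m = Suc (Suc R) + m'" using m(1) le_Suc_ex by blast
      have "replicate (Suc (Suc R)) y @ replicate m' y \<in> carrier (free_group k)"
        using replicate_last_closed[of "[y]" k "Suc R + m'"] y by (simp add: replicate_add)
      then have "D (replicate (Suc (Suc R)) y @ replicate m' y) = D (replicate (Suc (Suc R)) y)"
        by (rule const) simp
      then show ?thesis by (simp add: m' \<kappa>_def replicate_add)
    qed
    then show ?thesis using m(2) x by simp
  qed
  let ?S = "\<Sum>i\<le>R. card (word_sphere k i)"
  have "n * gen_count (fst x) u \<le> card (crossings k D (wpow u n)) + (2 * card (word_ball k R) + ?S + 1)"
    if n: "n > 0" for n
  proof -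
    let ?U = "wpow u n"
    have U: "?U \<in> carrier (free_group k)" by (rule wpow_in_carrier)
    let ?near = "word_ball k R \<union> (\<lambda>g. reduce (g @ winv ?U)) ` word_ball k R"
    have same: "\<kappa> (take (Suc R) h) = D h" if "h \<in> carrier (free_group k)" "h \<notin> word_ball k R" for h
      using far that by (auto simp: word_ball_def)
    have recover: "g = reduce (reduce (g @ ?U) @ winv ?U)" if "g \<in> carrier (free_group k)" for g
      using that by (simp add: in_carrier reduce_reduced)
    have sub: "crossings k (\<lambda>g. \<kappa> (take (Suc R) g)) ?U \<subseteq> crossings k D ?U \<union> ?near"
    proof
      fix g assume g: "g \<in> crossings k (\<lambda>g. \<kappa> (take (Suc R) g)) ?U"
      then have gF: "g \<in> carrier (free_group k)" by (simp add: crossings_def)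
      show "g \<in> crossings k D ?U \<union> ?near"
      proof (cases "g \<in> word_ball k R \<or> reduce (g @ ?U) \<in> word_ball k R")
        case True
        then show ?thesis using recover[OF gF] by blast
      next
        case False
        then show ?thesis
          using g same[OF gF] same[OF mult_closed[OF gF U]] by (simp add: crossings_def)
      qed
    qed
    have finD: "finite (crossings k D ?U)"
    proof (rule finite_subset)
      show "crossings k D ?U \<subseteq> crossings k (\<lambda>g. \<kappa> (take (Suc R) g)) ?U \<union> ?near"
      proof
        fix g assume g: "g \<in> crossings k D ?U"
        then have gF: "g \<in> carrier (free_group k)" by (simp add: crossings_def)
        show "g \<in> crossings k (\<lambda>g. \<kappa> (take (Suc R) g)) ?U \<union> ?near"
        proof (cases "g \<in> word_ball k R \<or> reduce (g @ ?U) \<in> word_ball k R")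
          case True
          then show ?thesis using recover[OF gF] by blast
        next
          case False
          then show ?thesis
            using g same[OF gF] same[OF mult_closed[OF gF U]] by (simp add: crossings_def)
        qed
      qed
      show "finite (crossings k (\<lambda>g. \<kappa> (take (Suc R) g)) ?U \<union> ?near)"
        using finite_crossings_take[OF U] by simp
    qed
    have "card (crossings k (\<lambda>g. \<kappa> (take (Suc R) g)) ?U) \<le> card (crossings k D ?U \<union> ?near)"
      using finD by (intro card_mono[OF _ sub]) simp
    also have "\<dots> \<le> card (crossings k D ?U) + (card (word_ball k R) + card ((\<lambda>g. reduce (g @ winv ?U)) ` word_ball k R))"
      using card_Un_le[of "crossings k D ?U" ?near] card_Un_le[of "word_ball k R"] by (meson add_left_mono le_trans)
    also have "\<dots> \<le> card (crossings k D ?U) + 2 * card (word_ball k R)"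
      using card_image_le[OF finite_word_ball, of "\<lambda>g. reduce (g @ winv ?U)" k R] by simp
    finally show ?thesis
      using gen_count_le_crossings_colouring[of \<kappa>, OF straight n x flip, of R] by simp
  qed
  then show ?thesis by blast
qed

text \<open>Translating the cut moves the axis of \<open>x\<close> that it separates through the root.\<close>

lemma gen_count_le_crossings:
  assumes fin: "finite (cut_boundary k D)" and x: "x \<in> letters k" and h: "h \<in> carrier (free_group k)"
    and sep: "\<And>M. \<exists>m\<ge>M. D (reduce (h @ replicate m x)) \<noteq> D (reduce (h @ replicate m (linv x)))"
  shows "\<exists>C. \<forall>n>0. n * gen_count (fst x) u \<le> card (crossings k D (wpow u n)) + C"
proof -
  define D' where "D' g = D (reduce (h @ g))" for g
  note bij = bij_left_mult[OF h]
  have "bij_betw (\<lambda>g. reduce (h @ g)) (cut_boundary k D') (cut_boundary k D)"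
    unfolding cut_boundary_def using bij by (rule bij_betw_Collect_carrier) (simp add: D'_def)
  then have "finite (cut_boundary k D')" using fin bij_betw_finite by blast
  then obtain C where "\<forall>n>0. n * gen_count (fst x) u \<le> card (crossings k D' (wpow u n)) + C"
    using gen_count_le_crossings_from_origin[of D' x] x sep by (auto simp: D'_def)
  moreover have "card (crossings k D' U) = card (crossings k D U)" for U
  proof (rule bij_betw_same_card)
    show "bij_betw (\<lambda>g. reduce (h @ g)) (crossings k D' U) (crossings k D U)"
      unfolding crossings_def using bij by (rule bij_betw_Collect_carrier) (simp add: D'_def)
  qed
  ultimately show ?thesis by auto
qed

end

section \<open>Cut-minimal words are shortest in their automorphic orbit\<close>

text \<open>The half-space behind an edge of the Cayley tree that belongs to the basis which \<open>\<phi>\<close> maps to the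
  standard one.\<close>

definition basis_cut :: "(letter list \<Rightarrow> letter list) \<Rightarrow> nat \<Rightarrow> letter list \<Rightarrow> bool" where
  "basis_cut \<phi> j g \<longleftrightarrow> \<phi> g \<noteq> [] \<and> hd (\<phi> g) = (j, True)"

lemma hd_reduce_append:
  assumes "reduced a" "length w < length a"
  shows "reduce (a @ w) \<noteq> []" "hd (reduce (a @ w)) = hd a"
proof -
  have "length (reduce w) < length a" using length_reduce[of w] assms(2) by simp
  moreover obtain i s where "i \<le> length (reduce w)" "a = s @ winv (take i (reduce w))"
      "reduce (a @ reduce w) = s @ drop i (reduce w)"
    using cancellation[OF assms(1) reduced_reduce] by blast
  ultimately have "s \<noteq> []" "a = s @ winv (take i (reduce w))" "reduce (a @ w) = s @ drop i (reduce w)"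
    by auto
  then show "reduce (a @ w) \<noteq> []" "hd (reduce (a @ w)) = hd a" by simp_all
qed

lemma wpow_single: "wpow [x] n = replicate n x"
  by (induction n) auto

lemma replicate_closed: "x \<in> letters k \<Longrightarrow> replicate n x \<in> carrier (free_group k)"
  using reduced_wpow[of "[x]" n]
  by (auto simp: wpow_single in_carrier cyc_reduced_iff reduced_Cons)

lemma cyc_reduced_rotate: "cyc_reduced u \<Longrightarrow> cyc_reduced (rotate n u)"
  by (simp add: cyc_reduced_def rotate_rotate)

lemma cyc_reduced_winv: "cyc_reduced u \<Longrightarrow> cyc_reduced (winv u)"
  by (auto simp: cyc_reduced_iff hd_winv last_winv)

context
  fixes k \<phi> assumes \<phi>: "\<phi> \<in> auto (free_group k)"
begin

text \<open>A common prefix of both images would put the two ends on the same side.\<close>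

lemma basis_cut_crossing_cases:
  assumes g: "g \<in> carrier (free_group k)" and U: "U \<in> carrier (free_group k)"
    and ne: "basis_cut \<phi> j g \<noteq> basis_cut \<phi> j (reduce (g @ U))"
  obtains i where "i \<le> length (\<phi> U)" "\<phi> g = winv (take i (\<phi> U))"
    "\<phi> (reduce (g @ U)) = drop i (\<phi> U)"
proof -
  obtain i s where i: "i \<le> length (\<phi> U)" "\<phi> g = s @ winv (take i (\<phi> U))"
      "reduce (\<phi> g @ \<phi> U) = s @ drop i (\<phi> U)"
    using cancellation[OF aut_reduced[OF \<phi> g] aut_reduced[OF \<phi> U]] by blast
  have "s = []"
  proof (rule ccontr)
    assume "s \<noteq> []"
    then show False using ne i aut_mult[OF \<phi> g U] by (simp add: basis_cut_def)
  qed
  then show thesis using that i aut_mult[OF \<phi> g U] by simp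
qed

lemma finite_cut_boundary_basis_cut: "finite (cut_boundary k (basis_cut \<phi> j))"
proof -
  let ?F = "carrier (free_group k)"
  define R where "R = Max ((\<lambda>x. length (\<phi> [x])) ` letters k)"
  have "\<phi> ` cut_boundary k (basis_cut \<phi> j) \<subseteq> word_ball k R"
  proof
    fix h assume "h \<in> \<phi> ` cut_boundary k (basis_cut \<phi> j)"
    then obtain g x where gx: "h = \<phi> g" "g \<in> ?F" "x \<in> letters k"
      "basis_cut \<phi> j g \<noteq> basis_cut \<phi> j (reduce (g @ [x]))"
      by (auto simp: cut_boundary_def)
    then obtain i where "\<phi> g = winv (take i (\<phi> [x]))"
      using basis_cut_crossing_cases[of g "[x]" j] by auto
    then have "length (\<phi> g) \<le> length (\<phi> [x])" by simp
    also have "\<dots> \<le> R" unfolding R_def using gx(3) by (intro Max_ge) auto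
    finally show "h \<in> word_ball k R" using gx aut_closed[OF \<phi>] by (simp add: word_ball_def)
  qed
  then have "finite (\<phi> ` cut_boundary k (basis_cut \<phi> j))" by (rule finite_subset) simp
  moreover have "inj_on \<phi> (cut_boundary k (basis_cut \<phi> j))"
    using aut_bij[OF \<phi>] by (auto simp: bij_betw_def cut_boundary_def elim: inj_on_subset)
  ultimately show ?thesis by (rule finite_imageD)
qed

text \<open>In the tree of the other basis the path \<open>U\<close> is the geodesic that reads \<open>\<phi> U\<close>. It crosses an edge
  labelled \<open>j\<close> at each occurrence of the generator \<open>j\<close> and at no other place.\<close>

lemma card_crossings_basis_cut:
  assumes U: "U \<in> carrier (free_group k)"
  shows "card (crossings k (basis_cut \<phi> j) U) \<le> gen_count j (\<phi> U)"
proof -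
  let ?V = "\<phi> U" and ?F = "carrier (free_group k)"
  let ?I = "{l. l < length ?V \<and> fst (?V ! l) = j}"
  let ?pt = "\<lambda>l. if snd (?V ! l) then winv (take l ?V) else winv (take (Suc l) ?V)"
  have "\<phi> ` crossings k (basis_cut \<phi> j) U \<subseteq> ?pt ` ?I"
  proof
    fix h assume "h \<in> \<phi> ` crossings k (basis_cut \<phi> j) U"
    then obtain g where g: "h = \<phi> g" "g \<in> ?F" "basis_cut \<phi> j g \<noteq> basis_cut \<phi> j (reduce (g @ U))"
      by (auto simp: crossings_def)
    then obtain i where i: "i \<le> length ?V" "\<phi> g = winv (take i ?V)" "\<phi> (reduce (g @ U)) = drop i ?V"
      using basis_cut_crossing_cases[OF g(2) U g(3)] by blast
    show "h \<in> ?pt ` ?I"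
    proof (cases "basis_cut \<phi> j g")
      case True
      then obtain l where l: "i = Suc l" using i by (cases i) (auto simp: basis_cut_def)
      then have "linv (?V ! l) = (j, True)"
        using True i by (simp add: basis_cut_def winv_take_Suc)
      then have "?V ! l = (j, False)" by (simp add: linv_def prod_eq_iff)
      then show ?thesis using i l g(1) by (intro image_eqI[of _ _ l]) auto
    next
      case False
      then have "basis_cut \<phi> j (reduce (g @ U))" using g by simp
      then have "i < length ?V" "?V ! i = (j, True)"
        using i by (auto simp: basis_cut_def hd_drop_conv_nth not_le)
      then show ?thesis using i g(1) by (intro image_eqI[of _ _ i]) auto
    qed
  qed
  then have "card (\<phi> ` crossings k (basis_cut \<phi> j) U) \<le> card ?I"
    by (rule surj_card_le[rotated]) simp
  moreover have "inj_on \<phi> (crossings k (basis_cut \<phi> j) U)"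
    using aut_bij[OF \<phi>] by (auto simp: bij_betw_def crossings_def elim: inj_on_subset)
  ultimately show ?thesis
    by (simp add: card_image gen_count_def length_filter_conv_card)
qed

lemma aut_replicate: "x \<in> letters k \<Longrightarrow> \<phi> (replicate m x) = reduce (wpow (\<phi> [x]) m)"
  using aut_wpow[OF \<phi>, of "[x]" m] replicate_closed[of x k m]
  by (simp add: wpow_single reduce_reduced in_carrier reduced_Cons)

text \<open>After a rotation the cyclic form of \<open>\<phi> [x]\<close> starts with \<open>j\<close>. Seen from a suitable vertex, the positive
  powers of \<open>x\<close> then lead to words that start with \<open>j\<close>. The negative powers lead to words that start
  with the inverse of the last letter of the rotated form, which differs from \<open>j\<close> by cyclic reducedness.\<close>

lemma basis_cut_separates:
  assumes x: "x \<in> letters k" and z: "(j, True) \<in> set (cyc_form (\<phi> [x]))"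
  obtains h where "h \<in> carrier (free_group k)"
    "\<And>M. \<exists>m\<ge>M. basis_cut \<phi> j (reduce (h @ replicate m x)) \<and>
       \<not> basis_cut \<phi> j (reduce (h @ replicate m (linv x)))"
proof -
  let ?F = "carrier (free_group k)"
  have xF: "[x] \<in> ?F" using x by simp
  define V where "V = \<phi> [x]"
  have V: "reduced V" "set V \<subseteq> letters k" using aut_closed[OF \<phi> xF] by (simp_all add: V_def in_carrier)
  obtain v where v: "V = v @ cyc_form V @ winv v" and cyc: "cyc_reduced (cyc_form V)"
    using cyc_form[OF V(1)] by blast
  obtain z1 z2 where z12: "cyc_form V = z1 @ (j, True) # z2"
    using z split_list unfolding V_def by metis
  define z' where "z' = (j, True) # z2 @ z1"
  define v' where "v' = v @ z1"
  have z': "cyc_reduced z'" "z' \<noteq> []" "hd z' = (j, True)"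
    using cyc_reduced_rotate[OF cyc, of "length z1"] by (simp_all add: z'_def z12 rotate_append)
  have V': "V = reduce (v' @ z' @ winv v')"
  proof -
    have "V = reduce ((v @ z1 @ (j, True) # z2) @ winv v)" using v V(1) z12 by (simp add: reduce_reduced)
    also have "\<dots> = reduce ((v @ z1 @ (j, True) # z2) @ z1 @ winv z1 @ winv v)"
      by (simp only: reduce_winv_cancel)
    finally show ?thesis by (simp add: v'_def z'_def)
  qed
  have "set v' \<subseteq> letters k" using V(2) v z12 by (metis v'_def le_sup_iff set_append)
  then have "reduce (winv v') \<in> ?F" by (intro reduce_in_carrier) simp
  then obtain h where h: "h \<in> ?F" "\<phi> h = reduce (winv v')"
    using aut_bij[OF \<phi>] by (metis bij_betw_iff_bijections)
  have pos: "\<phi> (reduce (h @ replicate m x)) = reduce (wpow z' m @ winv v')" for m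
  proof -
    have "\<phi> (reduce (h @ replicate m x)) = reduce (winv v' @ wpow V m)"
      using aut_mult[OF \<phi> h(1) replicate_closed[OF x]] aut_replicate[OF x] h(2) by (simp add: V_def)
    also have "\<dots> = reduce (winv v' @ reduce (wpow V m))" by simp
    also have "\<dots> = reduce (winv v' @ v' @ wpow z' m @ winv v')"
      unfolding V' reduce_wpow_reduce reduce_wpow_conj by simp
    finally show ?thesis by simp
  qed
  have neg: "\<phi> (reduce (h @ replicate m (linv x))) = reduce (winv (wpow z' m) @ winv v')" for m
  proof -
    have "replicate m (linv x) = winv (replicate m x)" by (simp add: winv_def)
    then have "\<phi> (reduce (h @ replicate m (linv x))) = reduce (winv v' @ winv (reduce (wpow V m)))"
      using aut_mult[OF \<phi> h(1), of "winv (replicate m x)"] replicate_closed[OF x, of m]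
        aut_replicate[OF x, of m] aut_winv[OF \<phi> replicate_closed[OF x, of m]] h(2)
      by (simp add: V_def)
    also have "\<dots> = reduce (winv v' @ v' @ winv (wpow z' m) @ winv v')"
      unfolding V' reduce_wpow_reduce reduce_wpow_conj by (simp add: winv_reduce)
    finally show ?thesis by simp
  qed
  have "\<exists>m\<ge>M. basis_cut \<phi> j (reduce (h @ replicate m x)) \<and>
       \<not> basis_cut \<phi> j (reduce (h @ replicate m (linv x)))" for M
  proof (intro exI conjI)
    let ?m = "Suc (M + length v')"
    have red: "reduced (wpow z' ?m)" by (rule reduced_wpow[OF z'(1)])
    have "length v' < ?m * 1" by simp
    also have "\<dots> \<le> ?m * length z'" using z'(2) by (intro mult_le_mono2) (simp add: Suc_le_eq)
    finally have len: "length (winv v') < length (wpow z' ?m)" by (simp only: length_wpow winv_simps)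
    show "basis_cut \<phi> j (reduce (h @ replicate ?m x))"
      using hd_reduce_append[OF red len] hd_wpow[of ?m z'] z'
      by (simp only: basis_cut_def pos) simp
    have "hd (winv (wpow z' ?m)) = linv (last z')"
      using z'(2) last_wpow[of ?m z'] by (subst hd_winv) (simp_all del: replicate_Suc)
    then show "\<not> basis_cut \<phi> j (reduce (h @ replicate ?m (linv x)))"
      using hd_reduce_append[of "winv (wpow z' ?m)" "winv v'"] red len z'
      by (simp add: basis_cut_def neg cyc_reduced_iff del: replicate_Suc) (metis)
  qed simp
  then show thesis using that h(1) by blast
qed

end

lemma expsum_cyc_form:
  assumes "reduced w"
  shows "expsum j w = expsum j (cyc_form w)"
proof -
  obtain v where "w = v @ cyc_form w @ winv v" using cyc_form[OF assms] by blast
  then have "expsum j w = expsum j (v @ cyc_form w @ winv v)" by simp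
  then show ?thesis by simp
qed

lemma expsum_nonzero:
  assumes "expsum j w \<noteq> 0"
  shows "(j, True) \<in> set w \<or> (j, True) \<in> set (winv w)"
proof (rule ccontr)
  assume c: "\<not> ?thesis"
  have "\<forall>x\<in>set w. fst x \<noteq> j"
  proof
    fix x assume "x \<in> set w"
    moreover from this have "linv x \<in> set (winv w)" by (simp add: winv_def)
    moreover have "x = (j, True) \<or> linv x = (j, True)" if "fst x = j"
      using that by (auto simp: linv_def prod_eq_iff)
    ultimately show "fst x \<noteq> j" using c by auto
  qed
  then have "expsum j w = 0" by (induction w) (simp_all add: lsign_def)
  then show False using assms by simp
qed

lemma cyc_form_winv:
  assumes "reduced w"
  shows "cyc_form (winv w) = winv (cyc_form w)"
proof -
  obtain v where v: "w = v @ cyc_form w @ winv v" and c: "cyc_reduced (cyc_form w)"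
    using cyc_form[OF assms] by blast
  then have "winv w = v @ winv (cyc_form w) @ winv v" by (metis append_assoc winv_simps(3,4))
  then show ?thesis using cyc_form_eqI[OF cyc_reduced_winv[OF c], of v] by simp
qed

text \<open>Both bounds for the crossings of the cuts of the new basis are linear in the exponent \<open>n\<close> of the
  power \<open>wpow u n\<close>; comparing the slopes gives the claim.\<close>

theorem cut_minimal_shortest:
  assumes min: "cut_minimal k u" and u: "cyc_reduced u" "u \<noteq> []" "set u \<subseteq> letters k"
    and \<phi>: "\<phi> \<in> auto (free_group k)"
  shows "length u \<le> cyc_length (\<phi> u)"
proof -
  let ?F = "carrier (free_group k)"
  have uF: "u \<in> ?F" using u by (simp add: in_carrier cyc_reduced_iff)
  have pF: "wpow u n \<in> ?F" for n by (rule wpow_in_carrier[OF min u])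
  obtain \<pi> where \<pi>: "\<pi> permutes {0..<k}" "\<And>j. j < k \<Longrightarrow> expsum j (\<phi> [(\<pi> j, True)]) \<noteq> 0"
    using expsum_permutation[OF \<phi>] by blast
  have "\<exists>C. \<forall>n>0. n * gen_count (\<pi> j) u \<le> gen_count j (\<phi> (wpow u n)) + C" if j: "j < k" for j
  proof -
    have x: "(\<pi> j, True) \<in> letters k" using permutes_in_image[OF \<pi>(1), of j] j by (simp add: letters_def)
    then have V: "reduced (\<phi> [(\<pi> j, True)])" using aut_reduced[OF \<phi>] by simp
    have "expsum j (cyc_form (\<phi> [(\<pi> j, True)])) \<noteq> 0"
      using \<pi>(2)[OF j] expsum_cyc_form[OF V] by simp
    then have "(j, True) \<in> set (cyc_form (\<phi> [(\<pi> j, True)])) \<or>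
        (j, True) \<in> set (cyc_form (\<phi> [linv (\<pi> j, True)]))"
      using expsum_nonzero cyc_form_winv[OF V] aut_winv[OF \<phi>, of "[(\<pi> j, True)]"] x by fastforce
    then obtain y where y: "y \<in> letters k" "fst y = \<pi> j" "(j, True) \<in> set (cyc_form (\<phi> [y]))"
      using x by (metis fst_conv fst_linv linv_letters)
    obtain h where h: "h \<in> ?F" "\<And>M. \<exists>m\<ge>M. basis_cut \<phi> j (reduce (h @ replicate m y)) \<and>
        \<not> basis_cut \<phi> j (reduce (h @ replicate m (linv y)))"
      using basis_cut_separates[OF \<phi> y(1,3)] by blast
    have "\<exists>m\<ge>M. basis_cut \<phi> j (reduce (h @ replicate m y)) \<noteq>
        basis_cut \<phi> j (reduce (h @ replicate m (linv y)))" for M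
      using h(2)[of M] by blast
    then obtain C where "\<forall>n>0. n * gen_count (fst y) u \<le>
        card (crossings k (basis_cut \<phi> j) (wpow u n)) + C"
      using gen_count_le_crossings[OF min u finite_cut_boundary_basis_cut[OF \<phi>] y(1) h(1)] by blast
    then have "n * gen_count (\<pi> j) u \<le> card (crossings k (basis_cut \<phi> j) (wpow u n)) + C"
      if "n > 0" for n using y(2) that by auto
    then have "n * gen_count (\<pi> j) u \<le> gen_count j (\<phi> (wpow u n)) + C" if "n > 0" for n
      using card_crossings_basis_cut[OF \<phi> pF, of j n] that by (meson add_le_mono1 le_trans)
    then show ?thesis by blast
  qed
  then obtain C where C: "\<And>j n. j < k \<Longrightarrow> n > 0 \<Longrightarrow>
      n * gen_count (\<pi> j) u \<le> gen_count j (\<phi> (wpow u n)) + C j" by metis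
  obtain c where c: "\<And>n. n > 0 \<Longrightarrow> length (reduce (wpow (\<phi> u) n)) = n * cyc_length (\<phi> u) + c"
    using length_reduce_wpow[OF aut_reduced[OF \<phi> uF]] by blast
  have "n * length u \<le> n * cyc_length (\<phi> u) + (c + (\<Sum>j<k. C j))" if n: "n > 0" for n
  proof -
    have "length u = (\<Sum>j<k. gen_count j u)" using sum_gen_count[OF u(3)] by simp
    also have "\<dots> = (\<Sum>j<k. gen_count (\<pi> j) u)"
      using sum.permute[OF \<pi>(1), of "\<lambda>j. gen_count j u"] by (simp add: atLeast0LessThan)
    finally have "n * length u = (\<Sum>j<k. n * gen_count (\<pi> j) u)" by (simp add: sum_distrib_left)
    also have "\<dots> \<le> (\<Sum>j<k. gen_count j (\<phi> (wpow u n)) + C j)"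
      using C n by (intro sum_mono) auto
    also have "\<dots> = length (\<phi> (wpow u n)) + (\<Sum>j<k. C j)"
      using sum_gen_count[of "\<phi> (wpow u n)" k] aut_closed[OF \<phi> pF]
      by (simp add: sum.distrib in_carrier)
    also have "\<phi> (wpow u n) = reduce (wpow (\<phi> u) n)"
      using aut_wpow[OF \<phi> uF, of n] pF[of n] by (simp add: reduce_reduced in_carrier)
    finally show ?thesis using c[OF n] by simp
  qed
  then show ?thesis by (rule linear_bound_imp_le)
qed

section \<open>Large deviations for sums over consecutive letters\<close>

definition extensions :: "nat \<Rightarrow> nat \<Rightarrow> letter \<Rightarrow> letter list set" where
  "extensions k n x = {w \<in> word_sphere k n. w = [] \<or> hd w \<noteq> linv x}"

lemma finite_extensions [simp]: "finite (extensions k n x)"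
  by (rule finite_subset[OF _ finite_word_sphere[of k n]]) (auto simp: extensions_def)

lemma sphere_0 [simp]: "word_sphere k 0 = {[]}" and extensions_0 [simp]: "extensions k 0 x = {[]}"
  by (auto simp: word_sphere_def extensions_def)

lemma Cons_in_sphere: "y # w \<in> word_sphere k (Suc n) \<longleftrightarrow> y \<in> letters k \<and> w \<in> extensions k n y"
  by (auto simp: word_sphere_def extensions_def in_carrier reduced_Cons)

lemma sum_sphere_Suc:
  "sum f (word_sphere k (Suc n)) = (\<Sum>y\<in>letters k. \<Sum>w\<in>extensions k n y. f (y # w))"
proof -
  have "(\<Sum>y\<in>letters k. \<Sum>w\<in>extensions k n y. f (y # w)) =
      (\<Sum>(y, w)\<in>Sigma (letters k) (extensions k n). f (y # w))"
    by (rule sum.Sigma) auto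
  also have "\<dots> = sum f (word_sphere k (Suc n))"
    by (rule sum.reindex_bij_witness[where i = "\<lambda>w. (hd w, tl w)" and j = "\<lambda>(y, w). y # w"])
       (auto simp: Cons_in_sphere, auto simp: word_sphere_def extensions_def in_carrier reduced_Cons neq_Nil_conv length_Suc_conv)
  finally show ?thesis by simp
qed

lemma sum_extensions_Suc:
  "sum f (extensions k (Suc n) x) = (\<Sum>y\<in>letters k - {linv x}. \<Sum>w\<in>extensions k n y. f (y # w))"
proof -
  have "(\<Sum>y\<in>letters k - {linv x}. \<Sum>w\<in>extensions k n y. f (y # w)) =
      (\<Sum>(y, w)\<in>Sigma (letters k - {linv x}) (extensions k n). f (y # w))"
    by (rule sum.Sigma) auto
  also have "\<dots> = sum f (extensions k (Suc n) x)"
    by (rule sum.reindex_bij_witness[where i = "\<lambda>w. (hd w, tl w)" and j = "\<lambda>(y, w). y # w"])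
       (auto simp: extensions_def word_sphere_def in_carrier reduced_Cons neq_Nil_conv length_Suc_conv)
  finally show ?thesis by simp
qed

lemma card_extensions:
  assumes "k \<ge> 1" "x \<in> letters k"
  shows "card (extensions k n x) = (2 * k - 1) ^ n"
  using assms(2)
proof (induction n arbitrary: x)
  case (Suc n)
  have "card (extensions k (Suc n) x) = (\<Sum>y\<in>letters k - {linv x}. card (extensions k n y))"
    using sum_extensions_Suc[of "\<lambda>_. 1::nat"] by simp
  then show ?case using Suc by simp
qed simp

lemma card_sphere_Suc: "k \<ge> 1 \<Longrightarrow> card (word_sphere k (Suc n)) = 2 * k * (2 * k - 1) ^ n"
  using sum_sphere_Suc[of "\<lambda>_. 1::nat" k n] by (simp add: card_extensions)

lemma real_double_minus_1: "k \<ge> 1 \<Longrightarrow> real (2 * k - 1) = 2 * real k - 1"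
  by (simp add: of_nat_diff)

text \<open>The letters of a random reduced word form a Markov chain. The expected value of \<open>g\<close> for the next step
  depends on the current letter; a corrector \<open>h\<close>, the solution of the Poisson equation of the chain,
  evens it out to a constant \<open>c\<close>. As the transitions from \<open>x\<close> miss only the letter \<open>linv x\<close>, the equation
  couples only \<open>h x\<close> and \<open>h (linv x)\<close>, and has an explicit solution.\<close>

lemma corrector:
  fixes g :: "letter \<Rightarrow> letter \<Rightarrow> real"
  assumes k: "k \<ge> 2" and pos: "(\<Sum>x\<in>letters k. \<Sum>y\<in>letters k - {linv x}. g x y) > 0"
  obtains h c where "c > 0"
    "\<And>x. x \<in> letters k \<Longrightarrow> (\<Sum>y\<in>letters k - {linv x}. g x y + h y) - (2 * real k - 1) * h x = c"
proof -
  define q where "q = 2 * real k - 1"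
  define G where "G x = (\<Sum>y\<in>letters k - {linv x}. g x y)" for x
  define c where "c = (\<Sum>x\<in>letters k. G x) / (2 * real k)"
  define h where "h x = (q * (G x - c) - (G (linv x) - c)) / (q\<^sup>2 - 1)" for x
  have q: "q > 2" using k by (simp add: q_def)
  then have q2: "q\<^sup>2 - 1 \<noteq> 0" by (simp add: power2_eq_1_iff)
  have c: "c > 0" using pos k by (simp add: c_def G_def)
  have Ginv: "(\<Sum>x\<in>letters k. G (linv x)) = (\<Sum>x\<in>letters k. G x)"
    by (rule sum.reindex_bij_witness[where i = linv and j = linv]) auto
  have "(\<Sum>x\<in>letters k. G x) = 2 * real k * c" using k by (simp add: c_def)
  then have h0: "(\<Sum>x\<in>letters k. h x) = 0"
    using Ginv by (simp add: h_def sum_divide_distrib[symmetric] sum_subtractf sum_distrib_left[symmetric])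
  have "(\<Sum>y\<in>letters k - {linv x}. g x y + h y) - (2 * real k - 1) * h x = c" if x: "x \<in> letters k" for x
  proof -
    have "(\<Sum>y\<in>letters k. h y) = h (linv x) + (\<Sum>y\<in>letters k - {linv x}. h y)"
      using x by (intro sum.remove) auto
    then have "(\<Sum>y\<in>letters k - {linv x}. g x y + h y) - q * h x = G x - (h (linv x) + q * h x)"
      using h0 by (simp add: sum.distrib G_def)
    also have "h (linv x) + q * h x = (q\<^sup>2 - 1) * (G x - c) / (q\<^sup>2 - 1)"
      by (simp add: h_def add_divide_distrib[symmetric] algebra_simps power2_eq_square)
    also have "\<dots> = G x - c" using q2 by simp
    finally show ?thesis by (simp add: q_def)
  qed
  then show thesis using that c by blast
qed

text \<open>The inequality holds with equality at \<open>\<epsilon> = 0\<close>, \<open>V = 1\<close>, \<open>\<mu> = 2 * k - 1\<close>. The corrector makes the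
  derivative in \<open>\<epsilon>\<close> negative at every letter, even if \<open>\<mu>\<close> decreases at half the rate of the drift.\<close>

lemma supersolution:
  fixes g :: "letter \<Rightarrow> letter \<Rightarrow> real"
  assumes k: "k \<ge> 2" and pos: "(\<Sum>x\<in>letters k. \<Sum>y\<in>letters k - {linv x}. g x y) > 0"
  obtains \<epsilon> V \<mu> where "\<epsilon> > 0" "0 < \<mu>" "\<mu> < 2 * real k - 1" "\<And>x. x \<in> letters k \<Longrightarrow> V x > 0"
    "\<And>x. x \<in> letters k \<Longrightarrow> (\<Sum>y\<in>letters k - {linv x}. exp (- \<epsilon> * g x y) * V y) \<le> \<mu> * V x"
proof -
  define q where "q = 2 * real k - 1"
  obtain h c where c: "c > 0" and h: "\<And>x. x \<in> letters k \<Longrightarrow>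
      (\<Sum>y\<in>letters k - {linv x}. g x y + h y) - q * h x = c"
    using corrector[OF k pos] unfolding q_def by blast
  define f where "f x \<epsilon> = (\<Sum>y\<in>letters k - {linv x}. exp (- \<epsilon> * g x y) * (1 - \<epsilon> * h y)) -
      (q - \<epsilon> * (c / 2)) * (1 - \<epsilon> * h x)" for x \<epsilon>
  have ev1: "\<forall>\<^sub>F \<epsilon> in at_right 0. f x \<epsilon> < 0" if x: "x \<in> letters k" for x
  proof -
    have "real (card (letters k - {linv x})) = q" using x k by (simp add: q_def of_nat_diff)
    then have f0: "f x 0 = 0" by (simp add: f_def)
    have "(f x has_real_derivative (\<Sum>y\<in>letters k - {linv x}. - g x y * 1 + 1 * (- h y)) -
        (- (c / 2) * 1 + q * (- h x))) (at 0)"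
      unfolding f_def by (auto intro!: derivative_eq_intros sum.cong simp: algebra_simps)
    also have "(\<Sum>y\<in>letters k - {linv x}. - g x y * 1 + 1 * (- h y)) - (- (c / 2) * 1 + q * (- h x)) = - (c / 2)"
      using h[OF x] by (simp add: sum.distrib sum_negf sum_subtractf)
    finally have "(f x has_real_derivative - (c / 2)) (at 0)" .
    from DERIV_neg_dec_right[OF this] c obtain d where "d > 0" "\<And>\<epsilon>. 0 < \<epsilon> \<Longrightarrow> \<epsilon> < d \<Longrightarrow> f x \<epsilon> < 0"
      using f0 by auto
    then show ?thesis unfolding eventually_at_right_field by blast
  qed
  have ev2: "\<forall>\<^sub>F \<epsilon> in at_right 0. 1 - \<epsilon> * h x > 0" for x
    by (rule order_tendstoD(1)[where y = 1]) (auto intro!: tendsto_eq_intros)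
  have "\<forall>\<^sub>F \<epsilon> in at_right 0. (\<forall>x\<in>letters k. f x \<epsilon> < 0) \<and> (\<forall>x\<in>letters k. 1 - \<epsilon> * h x > 0) \<and> \<epsilon> > 0"
    using ev1 ev2 by (intro eventually_conj eventually_ball_finite eventually_at_right_less) auto
  then obtain \<epsilon> where \<epsilon>: "\<epsilon> > 0" "\<And>x. x \<in> letters k \<Longrightarrow> f x \<epsilon> < 0" "\<And>x. x \<in> letters k \<Longrightarrow> 1 - \<epsilon> * h x > 0"
    using eventually_happens'[OF trivial_limit_at_right_real] by (metis (no_types, lifting))
  define \<mu> where "\<mu> = q - \<epsilon> * (c / 2)"
  define V where "V x = 1 - \<epsilon> * h x" for x
  have sup: "(\<Sum>y\<in>letters k - {linv x}. exp (- \<epsilon> * g x y) * V y) < \<mu> * V x" if "x \<in> letters k" for x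
    using \<epsilon>(2)[OF that] by (simp add: f_def \<mu>_def V_def)
  have "(0, True) \<in> letters k" using k by (simp add: letters_def)
  moreover from this have "0 \<le> (\<Sum>y\<in>letters k - {linv (0, True)}. exp (- \<epsilon> * g (0, True) y) * V y)"
    using \<epsilon>(3) by (intro sum_nonneg) (auto simp: V_def less_imp_le)
  ultimately have "0 < \<mu> * V (0, True)" "V (0, True) > 0"
    using sup \<epsilon>(3) by (fastforce simp: V_def)+
  then have "\<mu> > 0" by (simp add: zero_less_mult_iff)
  moreover have "\<mu> < 2 * real k - 1" using \<epsilon>(1) c by (simp add: \<mu>_def q_def)
  ultimately show thesis using that[of \<epsilon> \<mu> V] \<epsilon> sup by (auto simp: V_def less_imp_le)
qed

text \<open>Markov's inequality for the exponential moment; the supersolution bounds the growth of the moment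
  sums by induction on the length.\<close>

lemma large_deviations:
  fixes g :: "letter \<Rightarrow> letter \<Rightarrow> real"
  assumes k: "k \<ge> 2" and pos: "(\<Sum>x\<in>letters k. \<Sum>y\<in>letters k - {linv x}. g x y) > 0"
  obtains \<mu> K where "0 < \<mu>" "\<mu> < 2 * real k - 1"
    "\<And>n. real (card {w \<in> word_sphere k n. pairsum g w \<le> t}) \<le> K * \<mu> ^ n"
proof -
  obtain \<epsilon> V \<mu> where \<epsilon>: "\<epsilon> > 0" and \<mu>: "0 < \<mu>" "\<mu> < 2 * real k - 1"
    and V: "\<And>x. x \<in> letters k \<Longrightarrow> V x > 0"
    and step: "\<And>x. x \<in> letters k \<Longrightarrow>
      (\<Sum>y\<in>letters k - {linv x}. exp (- \<epsilon> * g x y) * V y) \<le> \<mu> * V x"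
    by (rule supersolution[OF k pos]) (rule that)
  define v where "v = Min (V ` letters k)"
  have ne: "letters k \<noteq> {}" using k by (auto simp: letters_def lessThan_empty_iff)
  have v: "v > 0" "\<And>x. x \<in> letters k \<Longrightarrow> v \<le> V x"
    using V ne by (auto simp: v_def)
  have Z: "(\<Sum>w\<in>extensions k n x. exp (- \<epsilon> * pairsum g (x # w))) * v \<le> \<mu> ^ n * V x"
    if "x \<in> letters k" for n x
    using that
  proof (induction n arbitrary: x)
    case (Suc n)
    have "exp (- \<epsilon> * pairsum g (x # y # w)) = exp (- \<epsilon> * g x y) * exp (- \<epsilon> * pairsum g (y # w))" for y w
      by (simp add: pairsum_Cons exp_add[symmetric] algebra_simps)
    then have "(\<Sum>w\<in>extensions k (Suc n) x. exp (- \<epsilon> * pairsum g (x # w))) * v =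
        (\<Sum>y\<in>letters k - {linv x}. exp (- \<epsilon> * g x y) *
          ((\<Sum>w\<in>extensions k n y. exp (- \<epsilon> * pairsum g (y # w))) * v))"
      by (simp only: sum_extensions_Suc sum_distrib_left sum_distrib_right mult.assoc)
    also have "\<dots> \<le> (\<Sum>y\<in>letters k - {linv x}. exp (- \<epsilon> * g x y) * (\<mu> ^ n * V y))"
      using Suc.IH by (intro sum_mono mult_left_mono) auto
    also have "\<dots> = \<mu> ^ n * (\<Sum>y\<in>letters k - {linv x}. exp (- \<epsilon> * g x y) * V y)"
      by (simp add: sum_distrib_left algebra_simps)
    also have "\<dots> \<le> \<mu> ^ n * (\<mu> * V x)"
      using step[OF Suc.prems] \<mu> by (intro mult_left_mono) auto
    finally show ?case by (simp add: algebra_simps)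
  qed (use v in simp)
  define S where "S = (\<Sum>x\<in>letters k. V x)"
  have S: "S \<ge> 0" unfolding S_def by (intro sum_nonneg less_imp_le V)
  define K where "K = 1 + exp (\<epsilon> * t) * S / (v * \<mu>)"
  have K: "K \<ge> 1" using S v \<mu> by (simp add: K_def)
  have "real (card {w \<in> word_sphere k n. pairsum g w \<le> t}) \<le> K * \<mu> ^ n" for n
  proof (cases n)
    case 0
    have "card {w \<in> word_sphere k 0. pairsum g w \<le> t} \<le> card (word_sphere k 0)" by (intro card_mono) auto
    then show ?thesis using K 0 by simp
  next
    case (Suc m)
    let ?A = "{w \<in> word_sphere k (Suc m). pairsum g w \<le> t}"
    have "real (card ?A) = (\<Sum>w\<in>?A. 1)" by simp
    also have "\<dots> \<le> (\<Sum>w\<in>?A. exp (\<epsilon> * t) * exp (- \<epsilon> * pairsum g w))"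
      using \<epsilon> by (intro sum_mono) (auto simp: exp_add[symmetric])
    also have "\<dots> \<le> (\<Sum>w\<in>word_sphere k (Suc m). exp (\<epsilon> * t) * exp (- \<epsilon> * pairsum g w))"
      by (intro sum_mono2) auto
    also have "\<dots> = exp (\<epsilon> * t) * (\<Sum>x\<in>letters k. \<Sum>w\<in>extensions k m x. exp (- \<epsilon> * pairsum g (x # w)))"
      by (simp add: sum_sphere_Suc sum_distrib_left)
    also have "\<dots> \<le> exp (\<epsilon> * t) * (\<Sum>x\<in>letters k. \<mu> ^ m * V x / v)"
      using Z v by (intro mult_left_mono sum_mono) (auto simp: pos_le_divide_eq)
    also have "\<dots> = exp (\<epsilon> * t) * S / (v * \<mu>) * \<mu> ^ Suc m"
      using \<mu> v by (simp add: S_def sum_divide_distrib[symmetric] sum_distrib_left[symmetric])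
    also have "\<dots> \<le> K * \<mu> ^ Suc m"
      using \<mu> by (intro mult_right_mono) (auto simp: K_def)
    finally show ?thesis using Suc by simp
  qed
  then show thesis using that \<mu> by blast
qed

section \<open>Words that are not strictly minimal\<close>

text \<open>In the complete graph on the \<open>2 * k\<close> letters, a cut \<open>B\<close> has \<open>card B * (2 * k - card B)\<close> edges and a
  single vertex has \<open>2 * k - 1\<close>. Each edge counts twice, once for each orientation.\<close>

lemma straddle_total:
  assumes B: "B \<subseteq> letters k" and b: "b \<in> letters k" and k: "k \<ge> 1"
  shows "(\<Sum>x\<in>letters k. \<Sum>y\<in>letters k - {linv x}. real_of_int (straddle B x y) - of_bool (fst x = fst b))
    = 2 * (real (card B) - 1) * (2 * real k - 1 - real (card B))"
proof -
  have fin: "finite B" by (rule finite_subset[OF B]) simp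
  have cB: "card B \<le> 2 * k" using card_mono[OF finite_letters B] by simp
  have cc: "real (card (letters k - B)) = 2 * real k - real (card B)"
    using B fin cB by (simp add: card_Diff_subset of_nat_diff)
  have in1: "(\<Sum>y\<in>letters k - {linv x}. real_of_int (straddle B x y)) =
      (if linv x \<in> B then 2 * real k - real (card B) else real (card B))" if x: "x \<in> letters k" for x
  proof -
    have "(\<Sum>y\<in>letters k - {linv x}. real_of_int (straddle B x y)) =
        (\<Sum>y\<in>letters k. real_of_int (straddle B x y))"
      by (rule sum.mono_neutral_left) (auto simp: straddle_def)
    also have "\<dots> = (if linv x \<in> B then real (card (letters k \<inter> - B)) else real (card (letters k \<inter> B)))"
      by (simp add: straddle_def Compl_eq)
    finally show ?thesis using cc B by (simp add: Diff_eq Int_absorb1 Int_absorb2 inf.absorb2)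
  qed
  have "(\<Sum>x\<in>letters k. \<Sum>y\<in>letters k - {linv x}. real_of_int (straddle B x y)) =
      (\<Sum>x\<in>letters k. if linv x \<in> B then 2 * real k - real (card B) else real (card B))"
    using in1 by (intro sum.cong) auto
  also have "\<dots> = (\<Sum>z\<in>letters k. if z \<in> B then 2 * real k - real (card B) else real (card B))"
    by (rule sum.reindex_bij_witness[where i = linv and j = linv]) auto
  also have "\<dots> = real (card B) * (2 * real k - real (card B)) + (2 * real k - real (card B)) * real (card B)"
    using cc B by (simp add: sum.If_cases Int_absorb1 Diff_eq Compl_eq)
  finally have 1: "(\<Sum>x\<in>letters k. \<Sum>y\<in>letters k - {linv x}. real_of_int (straddle B x y)) =
      2 * real (card B) * (2 * real k - real (card B))" by simp
  have "{x \<in> letters k. fst x = fst b} = {b, linv b}" using b by (auto simp: fst_eq_iff)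
  then have "(\<Sum>x\<in>letters k. of_bool (fst x = fst b) :: real) = 2"
    by (simp add: Int_def)
  moreover have "(\<Sum>x\<in>letters k. \<Sum>y\<in>letters k - {linv x}. of_bool (fst x = fst b) :: real) =
      (\<Sum>x\<in>letters k. (2 * real k - 1) * of_bool (fst x = fst b))"
    using k by (intro sum.cong) (auto simp: of_nat_diff)
  ultimately have 2: "(\<Sum>x\<in>letters k. \<Sum>y\<in>letters k - {linv x}. of_bool (fst x = fst b) :: real) =
      2 * (2 * real k - 1)" by (simp add: sum_distrib_left[symmetric])
  show ?thesis unfolding sum_subtractf 1 2 by (simp add: algebra_simps)
qed

text \<open>The sum of this function over a cyclic word is the change of its length under \<open>wh b B\<close> if
  \<open>b \<in> B\<close> and \<open>linv b \<notin> B\<close>.\<close>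

definition drift :: "letter \<Rightarrow> letter set \<Rightarrow> letter \<Rightarrow> letter \<Rightarrow> real" where
  "drift b B x y = real_of_int (straddle B x y) - of_bool (fst x = fst b)"

definition proper_cuts :: "nat \<Rightarrow> (letter \<times> letter set) set" where
  "proper_cuts k = {(b, B). b \<in> letters k \<and> B \<subseteq> letters k \<and> 2 \<le> card B \<and> card B + 2 \<le> 2 * k}"

lemma finite_proper_cuts: "finite (proper_cuts k)"
  by (rule finite_subset[of _ "letters k \<times> Pow (letters k)"]) (auto simp: proper_cuts_def)

lemma drift_pairsum:
  "pairsum (drift b B) w = real_of_int (pairsum (\<lambda>x y. straddle B x y + of_bool (fst x \<noteq> fst b)) w)
     - real (length w - 1)"
  by (induction w rule: induct_list012)
     (auto simp: pairsum_Cons drift_def of_nat_diff)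

text \<open>The linear sum over \<open>u\<close> lacks the pair that closes the cyclic word, which accounts for the 1.\<close>

lemma not_SM_small_drift:
  assumes "u \<in> cyc_reduced_words k - SM k"
  shows "\<exists>(b, B) \<in> proper_cuts k. pairsum (drift b B) u \<le> 1"
proof -
  have u: "cyc_reduced u" "u \<in> carrier (free_group k)"
    using assms by (auto simp: cyc_reduced_words_def in_carrier cyc_reduced_iff)
  obtain \<tau> where \<tau>: "whitehead2 k \<tau>" "\<not> inner_aut k \<tau>" "cyc_length (\<tau> u) \<le> length u"
    using assms unfolding SM_def by (auto simp: not_less)
  obtain b B where b: "b \<in> letters k" "B \<subseteq> letters k" "b \<in> B" "linv b \<notin> B"
    "2 \<le> card B" "card B + 2 \<le> 2 * k" and \<tau>u: "\<tau> u = subst (wh b B) u"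
    using noninner_whitehead2[OF \<tau>(1,2)] u(2) by metis
  have "pairsum (drift b B) u \<le> 1"
  proof (cases "u = []")
    case False
    have "pairsum (drift b B) (u @ [hd u]) \<le> 0"
      using \<tau>(3) cyc_length_wh[OF b(3,4) u(1) False] unfolding drift_pairsum \<tau>u by simp
    moreover have "pairsum (drift b B) (u @ [hd u]) = pairsum (drift b B) u + drift b B (last u) (hd u)"
      using False pairsum_append[of u "[hd u]" "drift b B"] by simp
    moreover have "drift b B (last u) (hd u) \<ge> -1" by (simp add: drift_def straddle_def)
    ultimately show ?thesis by simp
  qed simp
  then show ?thesis using b by (intro bexI[of _ "(b, B)"]) (auto simp: proper_cuts_def)
qed

text \<open>Only finitely many cuts occur, and each one contributes an exponentially small set.\<close>

lemma card_not_SM: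
  assumes k: "k \<ge> 2"
  obtains \<mu> K where "0 < \<mu>" "\<mu> < 2 * real k - 1" "K \<ge> 0"
    "\<And>n. real (card {u \<in> cyc_reduced_words k - SM k. length u = n}) \<le> K * \<mu> ^ n"
proof -
  define bad where "bad n = (\<lambda>(b, B). {w \<in> word_sphere k n. pairsum (drift b B) w \<le> 1})" for n
  have "\<exists>\<mu> K. 0 < \<mu> \<and> \<mu> < 2 * real k - 1 \<and> (\<forall>n. real (card (bad n c)) \<le> K * \<mu> ^ n)"
    if c: "c \<in> proper_cuts k" for c
  proof -
    obtain b B where bB: "c = (b, B)" "b \<in> letters k" "B \<subseteq> letters k" "2 \<le> card B" "card B + 2 \<le> 2 * k"
      using c by (auto simp: proper_cuts_def)
    have "0 < 2 * (real (card B) - 1) * (2 * real k - 1 - real (card B))"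
      using bB by (intro mult_pos_pos) auto
    then have "(\<Sum>x\<in>letters k. \<Sum>y\<in>letters k - {linv x}. drift b B x y) > 0"
      using straddle_total[OF bB(3,2)] k by (simp add: drift_def)
    then obtain \<mu> K where "0 < \<mu>" "\<mu> < 2 * real k - 1"
      "\<And>n. real (card {w \<in> word_sphere k n. pairsum (drift b B) w \<le> 1}) \<le> K * \<mu> ^ n"
      by (rule large_deviations[OF k, of _ 1]) (rule that)
    then show ?thesis unfolding bad_def bB(1) prod.case by blast
  qed
  then obtain \<mu> K where \<mu>: "\<And>c. c \<in> proper_cuts k \<Longrightarrow> 0 < \<mu> c \<and> \<mu> c < 2 * real k - 1"
    and K: "\<And>c n. c \<in> proper_cuts k \<Longrightarrow> real (card (bad n c)) \<le> K c * \<mu> c ^ n"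
    by metis
  \<comment> \<open>With the 1 the maximum is defined without exhibiting a cut, and \<open>M < 2 * k - 1\<close> persists.\<close>
  define M where "M = Max (insert 1 (\<mu> ` proper_cuts k))"
  have M: "1 \<le> M" "\<And>c. c \<in> proper_cuts k \<Longrightarrow> \<mu> c \<le> M"
    using finite_proper_cuts by (auto simp: M_def)
  have "M \<in> insert 1 (\<mu> ` proper_cuts k)"
    unfolding M_def using finite_proper_cuts by (intro Max_in) auto
  then have M': "M < 2 * real k - 1" using \<mu> k by auto
  have K0: "K c \<ge> 0" if "c \<in> proper_cuts k" for c
    using K[OF that, of 0] of_nat_0_le_iff[of "card (bad 0 c)", where 'a = real] by simp
  have "real (card {u \<in> cyc_reduced_words k - SM k. length u = n}) \<le> (\<Sum>c\<in>proper_cuts k. K c) * M ^ n" for n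
  proof -
    have "{u \<in> cyc_reduced_words k - SM k. length u = n} \<subseteq> (\<Union>c\<in>proper_cuts k. bad n c)"
    proof
      fix u assume u: "u \<in> {u \<in> cyc_reduced_words k - SM k. length u = n}"
      then have "u \<in> word_sphere k n"
        by (auto simp: word_sphere_def in_carrier cyc_reduced_words_def cyc_reduced_iff)
      then show "u \<in> (\<Union>c\<in>proper_cuts k. bad n c)"
        using not_SM_small_drift[of u k] u by (auto simp: bad_def)
    qed
    then have "card {u \<in> cyc_reduced_words k - SM k. length u = n} \<le> card (\<Union>c\<in>proper_cuts k. bad n c)"
      using finite_proper_cuts by (intro card_mono) (auto simp: bad_def)
    also have "\<dots> \<le> (\<Sum>c\<in>proper_cuts k. card (bad n c))"
      by (rule card_UN_le[OF finite_proper_cuts])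
    finally have "real (card {u \<in> cyc_reduced_words k - SM k. length u = n})
        \<le> (\<Sum>c\<in>proper_cuts k. real (card (bad n c)))" by (simp flip: of_nat_sum)
    also have "\<dots> \<le> (\<Sum>c\<in>proper_cuts k. K c * M ^ n)"
    proof (rule sum_mono)
      fix c assume c: "c \<in> proper_cuts k"
      have "real (card (bad n c)) \<le> K c * \<mu> c ^ n" by (rule K[OF c])
      also have "\<dots> \<le> K c * M ^ n"
        using \<mu>[OF c] M(2)[OF c] K0[OF c] by (intro mult_left_mono power_mono) auto
      finally show "real (card (bad n c)) \<le> K c * M ^ n" .
    qed
    finally show ?thesis by (simp add: sum_distrib_right)
  qed
  moreover have "(\<Sum>c\<in>proper_cuts k. K c) \<ge> 0" by (intro sum_nonneg K0)
  ultimately show thesis using that[of M "\<Sum>c\<in>proper_cuts k. K c"] M(1) M' by simp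
qed

section \<open>Growth of the complement of SM'\<close>

lemma sum_powers_le:
  fixes S :: "'a list set" and \<mu> \<nu> K :: real
  assumes fin: "\<And>m. finite {w \<in> S. length w = m}"
    and card: "\<And>m. real (card {w \<in> S. length w = m}) \<le> K * \<mu> ^ m"
    and \<mu>: "0 < \<mu>" "\<mu> < \<nu>"
  shows "(\<Sum>w\<in>{w \<in> S. length w \<le> n}. (1 / \<nu>) ^ length w) \<le> K * (1 / (1 - \<mu> / \<nu>))"
proof -
  let ?A = "{w \<in> S. length w \<le> n}"
  have K: "K \<ge> 0" using card[of 0] of_nat_0_le_iff[of "card {w \<in> S. length w = 0}", where 'a = real] by simp
  have "?A = (\<Union>m\<le>n. {w \<in> S. length w = m})" by auto
  then have finA: "finite ?A" using fin by auto
  have "(\<Sum>w\<in>?A. (1 / \<nu>) ^ length w) = (\<Sum>m\<le>n. \<Sum>w\<in>{w \<in> ?A. length w = m}. (1 / \<nu>) ^ length w)"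
    by (rule sum.group[symmetric]) (use finA in auto)
  also have "\<dots> = (\<Sum>m\<le>n. real (card {w \<in> S. length w = m}) * (1 / \<nu>) ^ m)"
  proof (rule sum.cong)
    fix m assume "m \<in> {..n}"
    then have "{w \<in> ?A. length w = m} = {w \<in> S. length w = m}" by auto
    then show "(\<Sum>w\<in>{w \<in> ?A. length w = m}. (1 / \<nu>) ^ length w) =
        real (card {w \<in> S. length w = m}) * (1 / \<nu>) ^ m" by simp
  qed simp
  also have "\<dots> \<le> (\<Sum>m\<le>n. (K * \<mu> ^ m) * (1 / \<nu>) ^ m)"
    using card \<mu> by (intro sum_mono mult_right_mono) auto
  also have "\<dots> = K * (\<Sum>m\<le>n. (\<mu> / \<nu>) ^ m)"
    by (simp add: sum_distrib_left power_divide)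
  also have "\<dots> \<le> K * (1 / (1 - \<mu> / \<nu>))"
  proof (rule mult_left_mono[OF _ K])
    have r: "norm (\<mu> / \<nu>) < 1" using \<mu> by simp
    have "(\<Sum>m\<le>n. (\<mu> / \<nu>) ^ m) \<le> (\<Sum>m. (\<mu> / \<nu>) ^ m)"
      using \<mu> by (intro sum_le_suminf summable_geometric[OF r]) auto
    then show "(\<Sum>m\<le>n. (\<mu> / \<nu>) ^ m) \<le> 1 / (1 - \<mu> / \<nu>)" by (simp add: suminf_geometric[OF r])
  qed
  finally show ?thesis .
qed

lemma cyc_form_decomp:
  assumes "w \<in> carrier (free_group k)"
  obtains v where "w = v @ cyc_form w @ winv v" "v \<in> carrier (free_group k)"
    "cyc_form w \<in> cyc_reduced_words k" "length w = 2 * length v + length (cyc_form w)"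
proof -
  have r: "reduced w" and s: "set w \<subseteq> letters k" using assms by (simp_all add: in_carrier)
  obtain v where v: "w = v @ cyc_form w @ winv v" using cyc_form(2)[OF r] by blast
  have "reduced v" using r by (subst (asm) v) (simp add: reduced_append)
  moreover have "set w = set v \<union> set (cyc_form w) \<union> set (winv v)"
    using arg_cong[OF v, of set] by auto
  moreover have "length w = 2 * length v + length (cyc_form w)" by (subst v) simp
  ultimately show thesis
    using that[OF v] s cyc_form(1)[OF r] by (auto simp: in_carrier cyc_reduced_words_def)
qed

lemma finite_length_le: "S \<subseteq> carrier (free_group k) \<Longrightarrow> finite {w \<in> S. length w \<le> n}"
  by (rule finite_subset[OF _ finite_word_ball[of k n]]) (auto simp: word_ball_def)

lemma rho_mono: "A \<subseteq> B \<Longrightarrow> B \<subseteq> carrier (free_group k) \<Longrightarrow> rho n A \<le> rho n B"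
  unfolding rho_def by (intro card_mono finite_length_le) auto

lemma cyc_reduced_words_carrier: "cyc_reduced_words k \<subseteq> carrier (free_group k)"
  by (auto simp: cyc_reduced_words_def in_carrier cyc_reduced_iff)

lemma card_sphere_le:
  assumes "k \<ge> 1"
  shows "real (card (word_sphere k m)) \<le> 2 * real k * (2 * real k - 1) ^ m"
proof (cases m)
  case (Suc i)
  have "(2 * real k - 1) ^ i \<le> (2 * real k - 1) ^ m"
    using Suc assms by (intro power_increasing) auto
  then have "2 * real k * (2 * real k - 1) ^ i \<le> 2 * real k * (2 * real k - 1) ^ m"
    by (intro mult_left_mono) auto
  then show ?thesis using assms by (simp add: card_sphere_Suc real_double_minus_1 Suc)
qed (use assms in simp)

lemma card_sphere_ge:
  assumes "k \<ge> 1"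
  shows "(2 * real k - 1) ^ m \<le> real (card (word_sphere k m))"
proof (cases m)
  case (Suc i)
  have "(2 * real k - 1) * (2 * real k - 1) ^ i \<le> 2 * real k * (2 * real k - 1) ^ i"
    using assms by (intro mult_right_mono) auto
  then show ?thesis using assms by (simp add: card_sphere_Suc real_double_minus_1 Suc)
qed simp

text \<open>A word outside \<open>SM' k\<close> is \<open>v u v\<^sup>-\<^sup>1\<close> with \<open>u\<close> from the negligible set just counted. The factor \<open>v\<close> is
  arbitrary but its length counts twice, so it contributes only the rate \<open>sqrt (2 * k - 1)\<close>. Weighting
  every pair \<open>(v, u)\<close> by \<open>\<theta> ^ (n - 2 * length v - length u) \<ge> 1\<close>, for a rate \<open>\<theta>\<close> above both, turns the
  count into a product of two geometric series.\<close>

lemma rho_not_SM':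
  assumes k: "k \<ge> 2"
  obtains \<theta> K where "1 < \<theta>" "\<theta> < 2 * real k - 1" "K > 0"
    "\<And>n. real (rho n (carrier (free_group k) - SM' k)) \<le> K * \<theta> ^ n"
proof -
  define q where "q = 2 * real k - 1"
  define Bad where "Bad = cyc_reduced_words k - SM k"
  let ?F = "carrier (free_group k)"
  have q: "q > 1" using k by (simp add: q_def)
  obtain \<mu> C where \<mu>: "0 < \<mu>" "\<mu> < q" "C \<ge> 0"
    and C: "\<And>n. real (card {u \<in> Bad. length u = n}) \<le> C * \<mu> ^ n"
    by (rule card_not_SM[OF k], rule that) (simp_all add: q_def Bad_def)
  have sq: "sqrt q < q"
  proof -
    have "sqrt q * 1 < sqrt q * sqrt q" using q by (intro mult_strict_left_mono) auto
    then show ?thesis using q by simp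
  qed
  obtain \<theta> where \<theta>: "max (max \<mu> (sqrt q)) 1 < \<theta>" "\<theta> < q"
    using dense[of "max (max \<mu> (sqrt q)) 1" q] sq \<mu> q by auto
  have "(sqrt q)\<^sup>2 < \<theta>\<^sup>2" using \<theta>(1) q by (intro power_strict_mono) auto
  then have q\<theta>: "q < \<theta>\<^sup>2" using q by simp
  define K1 where "K1 = 2 * real k * (1 / (1 - q / \<theta>\<^sup>2))"
  define K2 where "K2 = C * (1 / (1 - \<mu> / \<theta>))"
  have K1: "(\<Sum>v\<in>{v \<in> ?F. length v \<le> n}. (1 / \<theta>\<^sup>2) ^ length v) \<le> K1" for n
    unfolding K1_def
  proof (rule sum_powers_le)
    show "finite {v \<in> ?F. length v = m}" for m
      using finite_word_sphere[of k m] by (simp add: word_sphere_def)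
    show "real (card {v \<in> ?F. length v = m}) \<le> 2 * real k * q ^ m" for m
      using card_sphere_le[of k m] k by (simp add: word_sphere_def q_def)
  qed (use q q\<theta> in auto)
  have K2: "(\<Sum>u\<in>{u \<in> Bad. length u \<le> n}. (1 / \<theta>) ^ length u) \<le> K2" for n
    unfolding K2_def
  proof (rule sum_powers_le[OF _ C])
    have "{u \<in> Bad. length u = m} \<subseteq> word_sphere k m" for m
      using cyc_reduced_words_carrier by (auto simp: Bad_def word_sphere_def)
    then show "finite {u \<in> Bad. length u = m}" for m using finite_word_sphere finite_subset by blast
  qed (use \<theta> \<mu> in auto)
  have bound: "real (rho n (?F - SM' k)) \<le> K1 * K2 * \<theta> ^ n" for n
  proof -
    let ?V = "{v \<in> ?F. length v \<le> n}" and ?U = "{u \<in> Bad. length u \<le> n}"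
    let ?P = "{(v, u) \<in> ?V \<times> ?U. 2 * length v + length u \<le> n}"
    have finV: "finite ?V" by (rule finite_length_le[of _ k]) simp
    have finU: "finite ?U"
      using cyc_reduced_words_carrier by (intro finite_length_le[of _ k]) (auto simp: Bad_def)
    have finP: "finite ?P" by (rule finite_subset[of _ "?V \<times> ?U"]) (use finV finU in auto)
    have "{w \<in> ?F - SM' k. length w \<le> n} \<subseteq> (\<lambda>(v, u). v @ u @ winv v) ` ?P"
    proof
      fix w assume w: "w \<in> {w \<in> ?F - SM' k. length w \<le> n}"
      then obtain v where v: "w = v @ cyc_form w @ winv v" "v \<in> ?F" "cyc_form w \<in> cyc_reduced_words k"
        "length w = 2 * length v + length (cyc_form w)" using cyc_form_decomp[of w k] by blast
      then have "(v, cyc_form w) \<in> ?P" using w by (auto simp: Bad_def SM'_def)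
      then show "w \<in> (\<lambda>(v, u). v @ u @ winv v) ` ?P" using v(1) by (intro image_eqI[of _ _ "(v, cyc_form w)"]) auto
    qed
    then have "rho n (?F - SM' k) \<le> card ?P"
      unfolding rho_def using finP by (rule surj_card_le[rotated])
    then have "real (rho n (?F - SM' k)) \<le> (\<Sum>p\<in>?P. 1)" by simp
    also have "\<dots> \<le> (\<Sum>p\<in>?P. \<theta> ^ n * ((1 / \<theta>\<^sup>2) ^ length (fst p) * (1 / \<theta>) ^ length (snd p)))"
    proof (rule sum_mono)
      fix p assume "p \<in> ?P"
      then have le: "2 * length (fst p) + length (snd p) \<le> n" by auto
      have "1 \<le> \<theta> ^ (n - (2 * length (fst p) + length (snd p)))" using \<theta> by (intro one_le_power) auto
      also have "\<dots> = \<theta> ^ n * ((1 / \<theta>\<^sup>2) ^ length (fst p) * (1 / \<theta>) ^ length (snd p))"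
        using \<theta> le by (simp add: power_diff power_add power_mult power_divide)
      finally show "1 \<le> \<theta> ^ n * ((1 / \<theta>\<^sup>2) ^ length (fst p) * (1 / \<theta>) ^ length (snd p))" .
    qed
    also have "\<dots> \<le> (\<Sum>p\<in>?V \<times> ?U. \<theta> ^ n * ((1 / \<theta>\<^sup>2) ^ length (fst p) * (1 / \<theta>) ^ length (snd p)))"
      using finV finU \<theta> by (intro sum_mono2) auto
    also have "\<dots> = \<theta> ^ n * ((\<Sum>v\<in>?V. (1 / \<theta>\<^sup>2) ^ length v) * (\<Sum>u\<in>?U. (1 / \<theta>) ^ length u))"
      unfolding sum_product sum.cartesian_product by (simp only: sum_distrib_left split_def)
    also have "\<dots> \<le> \<theta> ^ n * (K1 * K2)"
    proof (intro mult_left_mono mult_mono K1 K2)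
      have "q / \<theta>\<^sup>2 < 1" using q\<theta> q by (subst pos_divide_less_eq) auto
      then show "0 \<le> K1" by (simp add: K1_def)
    qed (use \<theta> in \<open>auto intro!: sum_nonneg\<close>)
    finally show ?thesis by (simp add: mult.commute)
  qed
  have "real (rho n (?F - SM' k)) \<le> (\<bar>K1 * K2\<bar> + 1) * \<theta> ^ n" for n
  proof -
    have "K1 * K2 * \<theta> ^ n \<le> (\<bar>K1 * K2\<bar> + 1) * \<theta> ^ n" using \<theta> by (intro mult_right_mono) auto
    then show ?thesis using bound[of n] by linarith
  qed
  then show thesis using that[of \<theta> "\<bar>K1 * K2\<bar> + 1"] \<theta> by (simp add: q_def)
qed

section \<open>Orbits and strictly minimal words\<close>

text \<open>The automorphism that multiplies one other generator by \<open>a\<close> fixes \<open>[a]\<close>, and is not inner because it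
  changes the cyclic length of that generator.\<close>

lemma single_not_SM:
  assumes k: "k \<ge> 2" and a: "a \<in> letters k"
  shows "[a] \<notin> SM k" "[] \<notin> SM k"
proof -
  have "\<exists>i<k. i \<noteq> fst a" using k by (intro exI[of _ "if fst a = 0 then 1 else 0"]) auto
  then obtain i where i: "i < k" "i \<noteq> fst a" by blast
  define c where "c = (i, True)"
  have c: "c \<in> letters k" "fst c \<noteq> fst a" using i by (auto simp: c_def letters_def)
  then have ne: "c \<noteq> a" "c \<noteq> linv a" "linv c \<noteq> a" "linv c \<noteq> linv a" by auto
  define B where "B = {a, c}"
  have B: "a \<in> B" "linv a \<notin> B" using ne by (auto simp: B_def)
  define \<tau> where "\<tau> = restrict (subst (wh a B)) (carrier (free_group k))"
  have wh2: "whitehead2 k \<tau>" unfolding \<tau>_def by (rule wh_whitehead2[OF a])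
  have cyc: "cyc_reduced [x]" for x by (simp add: cyc_reduced_iff reduced_Cons)
  have "int (cyc_length (\<tau> [c])) = 2"
    using cyc_length_wh[OF B cyc, of c] c ne by (simp add: \<tau>_def pairsum_Cons straddle_def B_def)
  then have ni: "\<not> inner_aut k \<tau>"
    using inner_cyc_length[of k \<tau> "[c]"] c cyc_length_cyc_reduced[OF cyc[of c]] by auto
  have "int (cyc_length (\<tau> [a])) = 1"
    using cyc_length_wh[OF B cyc, of a] a B by (simp add: \<tau>_def pairsum_Cons straddle_def)
  then show "[a] \<notin> SM k" using wh2 ni by (auto simp: SM_def)
  have "\<tau> [] = []" by (simp add: \<tau>_def)
  moreover have "cyc_length [] = 0" using cyc_length_cyc_reduced[of "[]"] by (simp add: cyc_reduced_iff)
  ultimately show "[] \<notin> SM k" using wh2 ni by (auto simp: SM_def)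
qed

lemma aut_orbit_carrier: "w \<in> carrier (free_group k) \<Longrightarrow> aut_orbit k w \<subseteq> carrier (free_group k)"
  by (auto simp: aut_orbit_def aut_closed)

text \<open>Cyclic length is a conjugacy invariant, so the minimality of the cyclic form of \<open>v\<close> carries over to \<open>v\<close>.\<close>

lemma orbit_SM'_cyc_length_le:
  assumes w: "w \<in> carrier (free_group k)" and v: "v \<in> aut_orbit k w" "v \<in> SM' k"
    and v': "v' \<in> aut_orbit k w"
  shows "cyc_length v \<le> cyc_length v'"
proof (cases "cyc_form v = []")
  case False
  let ?F = "carrier (free_group k)"
  obtain \<phi> \<phi>' where \<phi>: "\<phi> \<in> auto (free_group k)" "v = \<phi> w" "\<phi>' \<in> auto (free_group k)" "v' = \<phi>' w"
    using v(1) v' by (auto simp: aut_orbit_def)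
  define \<psi> where "\<psi> = compose ?F \<phi>' (restrict (inv_into ?F \<phi>) ?F)"
  have "\<psi> \<in> auto (free_group k)"
    using aut_inv_into[OF \<phi>(1)] \<phi>(3) group.hom_compose[OF group_free_group] compose_Bij
    unfolding auto_def \<psi>_def by blast
  note \<psi> = this
  have vF: "v \<in> ?F" using aut_closed[OF \<phi>(1) w] \<phi>(2) by simp
  have "inv_into ?F \<phi> v = w"
    using aut_bij[OF \<phi>(1)] w \<phi>(2) by (simp add: bij_betw_inv_into_left)
  then have \<psi>v: "\<psi> v = v'" using vF \<phi>(4) by (simp add: \<psi>_def compose_def)
  obtain g where g: "v = g @ cyc_form v @ winv g" "g \<in> ?F" "cyc_form v \<in> cyc_reduced_words k"
    using cyc_form_decomp[OF vF] by blast
  have u: "cyc_form v \<in> SM k" using v(2) by (simp add: SM'_def)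
  have cyc: "cyc_reduced (cyc_form v)" "set (cyc_form v) \<subseteq> letters k"
    using g(3) by (auto simp: cyc_reduced_words_def)
  then have uF: "cyc_form v \<in> ?F" by (simp add: in_carrier cyc_reduced_iff)
  have "v = reduce (g @ cyc_form v @ winv g)" using g(1) vF by (metis in_carrier reduce_reduced)
  then have "v' = reduce (\<psi> g @ \<psi> (cyc_form v) @ winv (\<psi> g))"
    using aut_conj[OF \<psi> g(2) uF] \<psi>v by simp
  then have "cyc_length v' = cyc_length (\<psi> (cyc_form v))"
    using cyc_length_conj[OF aut_reduced[OF \<psi> uF]] by simp
  then show ?thesis
    using cut_minimal_shortest[OF SM_cut_minimal[OF u False] cyc(1) False cyc(2) \<psi>]
    by (simp add: cyc_length_def)
qed (simp add: cyc_length_def)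

text \<open>The strictly minimal part of the orbit has a fixed cyclic length. Replacing the cyclic form by a
  single letter \<open>a\<close> does not make the words longer and leads out of \<open>SM' k\<close>; the first half of the new word
  still determines the conjugating part, so the map is at most \<open>card (word_ball k m)\<close> to one.\<close>

lemma rho_aut_orbit:
  assumes k: "k \<ge> 2" and w: "w \<in> carrier (free_group k)"
  obtains M where "M \<ge> 1" "\<And>n. rho n (aut_orbit k w) \<le> M * rho n (carrier (free_group k) - SM' k)"
proof -
  let ?F = "carrier (free_group k)" and ?O = "aut_orbit k w"
  have OF: "?O \<subseteq> ?F" by (rule aut_orbit_carrier[OF w])
  show thesis
  proof (cases "?O \<inter> SM' k = {}")
    case True
    then have "?O \<subseteq> ?F - SM' k" using OF by blast
    then have "rho n ?O \<le> 1 * rho n (?F - SM' k)" for n using rho_mono[of ?O _ k n] by simp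
    then show thesis using that[of 1] by blast
  next
    case False
    then obtain v0 where v0: "v0 \<in> ?O" "v0 \<in> SM' k" by blast
    define m where "m = cyc_length v0"
    have m: "cyc_length v = m" if "v \<in> ?O" "v \<in> SM' k" for v
      unfolding m_def using orbit_SM'_cyc_length_le[OF w] that v0 by (intro antisym) auto
    have "rho n ?O \<le> (1 + card (word_ball k m)) * rho n (?F - SM' k)" for n
    proof -
      let ?Y = "{z \<in> ?F - SM' k. length z \<le> n}"
      let ?X = "{v \<in> ?O \<inter> SM' k. length v \<le> n}"
      let ?h = "\<lambda>z::letter list. take (length z div 2) z"
      have finY: "finite ?Y" by (intro finite_length_le[of _ k]) auto
      have "?X \<subseteq> (\<lambda>(z, u). ?h z @ u @ winv (?h z)) ` (?Y \<times> word_ball k m)"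
      proof
        fix v assume v: "v \<in> ?X"
        then have vF: "v \<in> ?F" using OF by auto
        obtain s where s: "v = s @ cyc_form v @ winv s" "s \<in> ?F" "cyc_form v \<in> cyc_reduced_words k"
          "length v = 2 * length s + length (cyc_form v)"
          using cyc_form_decomp[OF vF] by blast
        have len: "length (cyc_form v) = m" using m[of v] v by (simp add: cyc_length_def)
        have "cyc_form v \<in> SM k" using v by (simp add: SM'_def)
        then have ne: "cyc_form v \<noteq> []" using single_not_SM(2)[OF k, of "(0, True)"] k by (auto simp: letters_def)
        \<comment> \<open>A generator that does not cancel with the end of \<open>s\<close>.\<close>
        define a where "a = (if s = [] \<or> fst (last s) \<noteq> 0 then (0, True) else (1::nat, True))"
        have a: "a \<in> letters k" "s \<noteq> [] \<Longrightarrow> fst a \<noteq> fst (last s)" using k by (auto simp: a_def letters_def)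
        define z where "z = s @ [a] @ winv s"
        have "reduced z"
        proof (cases "s = []")
          case False
          then have "a \<noteq> linv (last s)" "last s \<noteq> a" using a(2) by auto
          then show ?thesis using s(2) False
            by (auto simp: z_def reduced_append reduced_Cons in_carrier hd_winv)
        qed (simp add: z_def reduced_Cons)
        then have zF: "z \<in> ?F" using s(2) a(1) by (simp add: z_def in_carrier)
        have "cyc_form z = [a]"
          unfolding z_def by (rule cyc_form_eqI) (simp add: cyc_reduced_iff reduced_Cons)
        then have "z \<notin> SM' k" using single_not_SM(1)[OF k a(1)] by (simp add: SM'_def)
        moreover have "length z \<le> n" using s(4) v ne by (cases "cyc_form v") (auto simp: z_def)
        ultimately have "z \<in> ?Y" using zF by simp
        moreover have "cyc_form v \<in> word_ball k m"
          using s(3) len cyc_reduced_words_carrier by (auto simp: word_ball_def)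
        moreover have "?h z = s" by (simp add: z_def)
        ultimately show "v \<in> (\<lambda>(z, u). ?h z @ u @ winv (?h z)) ` (?Y \<times> word_ball k m)"
          using s(1) by (intro image_eqI[of _ _ "(z, cyc_form v)"]) auto
      qed
      then have "card ?X \<le> card (?Y \<times> word_ball k m)"
        using finY by (intro surj_card_le) auto
      then have X: "card ?X \<le> rho n (?F - SM' k) * card (word_ball k m)"
        by (simp add: card_cartesian_product rho_def)
      have "{v \<in> ?O. length v \<le> n} \<subseteq> ?Y \<union> ?X" using OF by auto
      moreover have "finite ?X" using OF by (intro finite_length_le[of _ k]) auto
      ultimately have "rho n ?O \<le> card (?Y \<union> ?X)"
        unfolding rho_def using finY by (intro card_mono) auto
      also have "\<dots> \<le> rho n (?F - SM' k) + card ?X" unfolding rho_def by (rule card_Un_le)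
      finally show ?thesis using X by (simp add: algebra_simps)
    qed
    then show thesis using that[of "1 + card (word_ball k m)"] by simp
  qed
qed

section \<open>Genericity and growth rates\<close>

text \<open>A reduced word becomes cyclically reduced when a letter is appended that cancels neither with its end
  nor with its beginning; two of at least four letters are excluded.\<close>

lemma rho_cyc_reduced_ge:
  assumes k: "k \<ge> 2" and n: "n \<ge> 1"
  shows "(2 * real k - 1) ^ n / (2 * real k - 1) \<le> real (rho n (cyc_reduced_words k))"
proof -
  obtain m where m: "n = Suc m" using n by (cases n) auto
  define y where "y w = (SOME y. y \<in> letters k \<and> (w \<noteq> [] \<longrightarrow> y \<noteq> linv (last w) \<and> y \<noteq> linv (hd w)))"
    for w :: "letter list"
  have y: "y w \<in> letters k \<and> (w \<noteq> [] \<longrightarrow> y w \<noteq> linv (last w) \<and> y w \<noteq> linv (hd w))" for w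
    unfolding y_def
  proof (rule someI_ex)
    have "card {linv (last w), linv (hd w)} < card (letters k)"
      using k card_insert_le_m1[of 2 "{linv (hd w)}" "linv (last w)"] by simp
    then have "\<not> letters k \<subseteq> {linv (last w), linv (hd w)}" by (metis card_mono finite.emptyI finite_insert not_less)
    then show "\<exists>y. y \<in> letters k \<and> (w \<noteq> [] \<longrightarrow> y \<noteq> linv (last w) \<and> y \<noteq> linv (hd w))" by blast
  qed
  have "(\<lambda>w. w @ [y w]) ` word_sphere k m \<subseteq> {w \<in> cyc_reduced_words k. length w \<le> n}"
  proof
    fix v assume "v \<in> (\<lambda>w. w @ [y w]) ` word_sphere k m"
    then obtain w where w: "v = w @ [y w]" "w \<in> word_sphere k m" by blast
    then show "v \<in> {w \<in> cyc_reduced_words k. length w \<le> n}"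
      using y[of w] m linv_eq_iff[of "y w" "linv (hd w)"]
      by (cases "w = []") (auto simp: cyc_reduced_words_def word_sphere_def in_carrier cyc_reduced_iff
          reduced_append reduced_Cons)
  qed
  then have "card ((\<lambda>w. w @ [y w]) ` word_sphere k m) \<le> rho n (cyc_reduced_words k)"
    unfolding rho_def by (rule card_mono[OF finite_length_le[OF cyc_reduced_words_carrier]])
  moreover have "inj_on (\<lambda>w. w @ [y w]) (word_sphere k m)" by (auto simp: inj_on_def)
  ultimately have "card (word_sphere k m) \<le> rho n (cyc_reduced_words k)" by (simp add: card_image)
  then show ?thesis using card_sphere_ge[of k m] k by (simp add: m)
qed

lemma exp_negligibleI:
  fixes S :: "letter list set"
  assumes B: "B \<subseteq> S" and S: "S \<subseteq> carrier (free_group k)"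
    and \<theta>: "0 < \<theta>" "\<theta> < q" and K: "K > 0" "\<And>n. real (rho n B) \<le> K * \<theta> ^ n"
    and lower: "\<And>n. n \<ge> 1 \<Longrightarrow> q ^ n / q \<le> real (rho n S)"
  shows "exp_negligible B S"
proof -
  let ?x = "\<lambda>n. real (rho n (S - B)) / real (rho n S)"
  have q: "q > 0" using \<theta> by simp
  have bound: "\<bar>1 - ?x n\<bar> \<le> (K * q) * (\<theta> / q) ^ n" if n: "n \<ge> 1" for n
  proof -
    have "{w \<in> S. length w \<le> n} = {w \<in> S - B. length w \<le> n} \<union> {w \<in> B. length w \<le> n}"
      using B by auto
    then have "rho n S = rho n (S - B) + rho n B"
      unfolding rho_def using finite_length_le[of "S - B" k n] finite_length_le[of B k n] B S
      by (subst card_Un_disjoint[symmetric]) auto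
    moreover have pos: "real (rho n S) > 0" using lower[OF n] q by (smt (verit) divide_pos_pos zero_less_power)
    ultimately have "1 - ?x n = real (rho n B) / real (rho n S)" by (simp add: field_simps)
    also have "\<dots> \<le> (K * \<theta> ^ n) / (q ^ n / q)"
      using K lower[OF n] q \<theta> by (intro frac_le) auto
    also have "\<dots> = (K * q) * (\<theta> / q) ^ n" by (simp add: power_divide)
    finally have "1 - ?x n \<le> (K * q) * (\<theta> / q) ^ n" .
    moreover have "1 - ?x n \<ge> 0" using \<open>1 - ?x n = real (rho n B) / real (rho n S)\<close> by simp
    ultimately show ?thesis by simp
  qed
  have "(\<lambda>n. (K * q) * (\<theta> / q) ^ n) \<longlonglongrightarrow> (K * q) * 0"
    using \<theta> q by (intro tendsto_mult LIMSEQ_power_zero tendsto_const) simp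
  then have lim: "(\<lambda>n. (K * q) * (\<theta> / q) ^ n) \<longlonglongrightarrow> 0" by simp
  have "\<forall>\<^sub>F n in sequentially. norm (?x n - 1) \<le> (K * q) * (\<theta> / q) ^ n"
  proof (rule eventually_sequentiallyI[of 1])
    fix n :: nat assume "1 \<le> n"
    from bound[OF this] show "norm (?x n - 1) \<le> (K * q) * (\<theta> / q) ^ n"
      by (simp only: real_norm_def abs_minus_commute)
  qed
  from Lim_null_comparison[OF this lim] have "(\<lambda>n. ?x n - 1) \<longlonglongrightarrow> 0" .
  then have "?x \<longlonglongrightarrow> 1" by (rule LIM_zero_cancel)
  then have "converges_exp_fast ?x 1"
    unfolding converges_exp_fast_def using bound \<theta> q K
    by (intro conjI exI[of _ "\<theta> / q"] exI[of _ "K * q"]) auto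
  then show ?thesis using B by (auto simp: exp_negligible_def exp_generic_def)
qed

lemma growth_rate_mono_factor:
  assumes "M \<ge> 1" "\<And>n. rho n A \<le> M * rho n B"
  shows "growth_rate A \<le> growth_rate B"
proof -
  have "(\<lambda>n. ereal (root n (real M))) \<longlonglongrightarrow> ereal 1"
    using assms(1) by (intro tendsto_ereal LIMSEQ_root_const) simp
  then have lim: "limsup (\<lambda>n. ereal (root n (real M)) * ereal (root n (real (rho n B)))) =
      1 * growth_rate B"
    unfolding growth_rate_def by (subst ereal_limsup_lim_mult) (auto simp: one_ereal_def)
  have "growth_rate A \<le> limsup (\<lambda>n. ereal (root n (real M)) * ereal (root n (real (rho n B))))"
    unfolding growth_rate_def
  proof (rule Limsup_mono, unfold eventually_sequentially, intro exI allI impI)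
    fix n :: nat assume n: "1 \<le> n"
    have "real (rho n A) \<le> real M * real (rho n B)" using assms(2)[of n] by (metis of_nat_le_iff of_nat_mult)
    then have "root n (real (rho n A)) \<le> root n (real M * real (rho n B))" using n by simp
    then show "ereal (root n (real (rho n A))) \<le> ereal (root n (real M)) * ereal (root n (real (rho n B)))"
      by (simp add: real_root_mult)
  qed
  then show ?thesis using lim by simp
qed

lemma growth_rate_le:
  assumes "\<theta> > 0" "K > 0" "\<And>n. real (rho n A) \<le> K * \<theta> ^ n"
  shows "growth_rate A \<le> ereal \<theta>"
proof -
  have "(\<lambda>n. root n K * \<theta>) \<longlonglongrightarrow> 1 * \<theta>"
    using assms by (intro tendsto_mult LIMSEQ_root_const tendsto_const)
  then have lim: "limsup (\<lambda>n. ereal (root n K * \<theta>)) = ereal \<theta>"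
    by (intro lim_imp_Limsup) (auto intro: tendsto_ereal)
  have "growth_rate A \<le> limsup (\<lambda>n. ereal (root n K * \<theta>))"
    unfolding growth_rate_def
  proof (rule Limsup_mono, unfold eventually_sequentially, intro exI allI impI)
    fix n :: nat assume n: "1 \<le> n"
    then have "root n (real (rho n A)) \<le> root n (K * \<theta> ^ n)" using assms(3)[of n] by simp
    then show "ereal (root n (real (rho n A))) \<le> ereal (root n K * \<theta>)"
      using n assms(1) by (simp add: real_root_mult real_root_power_cancel)
  qed
  then show ?thesis using lim by simp
qed

theorem corollary3p1:
  fixes k :: nat and w :: "letter list"
  assumes "k \<ge> 2" and "w \<in> carrier (free_group k)"
  shows "exp_negligible (aut_orbit k w) (carrier (free_group k)) \<and>
         exp_negligible (cyc_reduced_words k \<inter> aut_orbit k w) (cyc_reduced_words k) \<and>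
         growth_rate (aut_orbit k w) \<le> growth_rate (carrier (free_group k) - SM' k) \<and>
         growth_rate (carrier (free_group k) - SM' k) < ereal (2 * real k - 1)"
proof -
  let ?F = "carrier (free_group k)" and ?C = "cyc_reduced_words k" and ?O = "aut_orbit k w"
  obtain \<theta> K where \<theta>: "1 < \<theta>" "\<theta> < 2 * real k - 1" "K > 0"
    and K: "\<And>n. real (rho n (?F - SM' k)) \<le> K * \<theta> ^ n"
    by (rule rho_not_SM'[OF assms(1)]) (rule that)
  obtain M where M: "M \<ge> 1" "\<And>n. rho n ?O \<le> M * rho n (?F - SM' k)"
    by (rule rho_aut_orbit[OF assms]) (rule that)
  have OF: "?O \<subseteq> ?F" by (rule aut_orbit_carrier[OF assms(2)])
  have O: "real (rho n ?O) \<le> (real M * K) * \<theta> ^ n" for n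
  proof -
    have "real (rho n ?O) \<le> real M * real (rho n (?F - SM' k))"
      using M(2)[of n] by (metis of_nat_le_iff of_nat_mult)
    also have "\<dots> \<le> real M * (K * \<theta> ^ n)" using K[of n] by (intro mult_left_mono) auto
    finally show ?thesis by (simp add: mult.assoc)
  qed
  have CO: "real (rho n (?C \<inter> ?O)) \<le> (real M * K) * \<theta> ^ n" for n
    using O[of n] rho_mono[of "?C \<inter> ?O" ?O k n] OF by simp
  have lowerC: "(2 * real k - 1) ^ n / (2 * real k - 1) \<le> real (rho n ?C)" if "n \<ge> 1" for n
    by (rule rho_cyc_reduced_ge[OF assms(1) that])
  have lowerF: "(2 * real k - 1) ^ n / (2 * real k - 1) \<le> real (rho n ?F)" if "n \<ge> 1" for n
    using lowerC[OF that] rho_mono[OF cyc_reduced_words_carrier order_refl, of n k] by simp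
  have MK: "real M * K > 0" "0 < \<theta>" using M \<theta> by simp_all
  have "exp_negligible ?O ?F"
    by (rule exp_negligibleI[OF OF order_refl MK(2) \<theta>(2) MK(1) O lowerF])
  moreover have "exp_negligible (?C \<inter> ?O) ?C"
    by (rule exp_negligibleI[OF _ cyc_reduced_words_carrier MK(2) \<theta>(2) MK(1) CO lowerC]) simp
  moreover have "growth_rate ?O \<le> growth_rate (?F - SM' k)"
    by (rule growth_rate_mono_factor[OF M])
  moreover have "growth_rate (?F - SM' k) < ereal (2 * real k - 1)"
    using growth_rate_le[OF MK(2) \<theta>(3) K] \<theta>(2) by (simp add: order_le_less_trans)
  ultimately show ?thesis by blast
qed

end
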